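(* The representation of $\mathrm{GL}(n)$ in the space $H_n$ determined by the reproducing kernel $K(\mathcal{V},\mathcal{W})=(-q)^{-k(\mathcal{V},\mathcal{W})}$ on $\mathrm{Fl}(n)$ coincides with (is equivalent to) the Steinberg representation of $\mathrm{GL}(n)$.
   Context: $\mathbb{F}_q$ is the field with $q$ elements; $\mathrm{GL}(n)=\mathrm{GL}_n(\mathbb{F}_q)$ acts on row vectors in $\mathbb{F}_q^n$ by $x\mapsto xg$. $\mathrm{Fl}(n)$ is the set of complete flags $\mathcal{V}: 0=V_0\subset V_1\subset\dots\subset V_n=\mathbb{F}_q^n$, $\dim V_j=j$. For $1\leq j\leq n-1$, $\mathrm{Fl}_j(n)$ is the set of incomplete flags containing one subspace of every dimension $0,\dots,n$ except $j$. For a finite set $Z$, $\ell_2(Z)$ is the space of complex functions on $Z$ with the $\ell_2$-inner product; $\mathrm{GL}(n)$ acts on $\ell_2(\mathrm{Fl}(n))$ and $\ell_2(\mathrm{Fl}_j(n))$ by the permutation representations. The Steinberg representation is the unique (up to equivalence) irreducible representation of $\mathrm{GL}(n)$ that is contained in $\ell_2(\mathrm{Fl}(n))$ and is not contained in any $\ell_2(\mathrm{Fl}_j(n))$, $1\leq j\leq n-1$. For $\mathcal{V},\mathcal{W}\in\mathrm{Fl}(n)$, $k(\mathcal{V},\mathcal{W})$ is the number of pairs $(i,j)$, with $i,j\in\{0,1,\dots,n-1\}$, such that $\dim (V_i\cap W_j)=\dim (V_{i+1}\cap W_{j+1})$. The kernel $K=(-q)^{-k}$ is positive definite (all matrices $\{K(\mathcal{V}_i,\mathcal{V}_j)\}$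 are positive semidefinite) and $\mathrm{GL}(n)$-invariant. The space $H_n$ determined by the reproducing kernel $K$ is the finite-dimensional complex inner product space spanned by vectors $\varphi_{\mathcal{V}}$, $\mathcal{V}\in\mathrm{Fl}(n)$, with $\langle\varphi_{\mathcal{V}},\varphi_{\mathcal{W}}\rangle=K(\mathcal{V},\mathcal{W})$; the group $\mathrm{GL}(n)$ acts on $H_n$ by the unitary representation permuting the vectors $\varphi_{\mathcal{V}}$ according to the action of $\mathrm{GL}(n)$ on $\mathrm{Fl}(n)$. *)

theory Defs
  imports "HOL-Analysis.Analysis" "HOL-Library.Function_Algebras"
begin

section \<open>Complex representations of the general linear group\<close>

definition GL :: "('a::field ^ 'n ^ 'n) set" where
  "GL = {g. invertible g}"

text \<open>A representation is carried by a subspace \<open>space_of R\<close> of a complex vector space with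
  underlying type \<^typ>\<open>'v\<close> and scalar multiplication \<open>scale_of R\<close>; only the values of
  \<open>act R g\<close> for \<open>g \<in> GL\<close> on that subspace are relevant.\<close>

record ('g, 'v) crep =
  space_of :: "'v set"
  scale_of :: "complex \<Rightarrow> 'v \<Rightarrow> 'v"
  act :: "'g \<Rightarrow> 'v \<Rightarrow> 'v"

definition clinear_between ::
  "('g, 'v::ab_group_add) crep \<Rightarrow> ('h, 'w::ab_group_add) crep \<Rightarrow> ('v \<Rightarrow> 'w) \<Rightarrow> bool" where
  "clinear_between R S T \<longleftrightarrow>
     (\<forall>x\<in>space_of R. T x \<in> space_of S) \<and>
     (\<forall>x\<in>space_of R. \<forall>y\<in>space_of R. T (x + y) = T x + T y) \<and>
     (\<forall>c. \<forall>x\<in>space_of R. T (scale_of R c x) = scale_of S c (T x))"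

definition representation ::
  "('a::field ^ 'n ^ 'n, 'v::ab_group_add) crep \<Rightarrow> bool" where
  "representation R \<longleftrightarrow>
     vector_space (scale_of R) \<and>
     module.subspace (scale_of R) (space_of R) \<and>
     (\<forall>g\<in>GL. clinear_between R R (act R g)) \<and>
     (\<forall>x\<in>space_of R. act R (mat 1) x = x) \<and>
     (\<forall>g\<in>GL. \<forall>h\<in>GL. \<forall>x\<in>space_of R. act R (g ** h) x = act R g (act R h x))"

definition invariant_subspace ::
  "('a::field ^ 'n ^ 'n, 'v::ab_group_add) crep \<Rightarrow> 'v set \<Rightarrow> bool" where
  "invariant_subspace R U \<longleftrightarrow>
     module.subspace (scale_of R) U \<and> U \<subseteq> space_of R \<and> (\<forall>g\<in>GL. \<forall>x\<in>U. act R g x \<in> U)"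

definition irreducible_rep ::
  "('a::field ^ 'n ^ 'n, 'v::ab_group_add) crep \<Rightarrow> bool" where
  "irreducible_rep R \<longleftrightarrow>
     representation R \<and> space_of R \<noteq> {0} \<and>
     (\<forall>U. invariant_subspace R U \<longrightarrow> U = {0} \<or> U = space_of R)"

definition rep_equiv ::
  "('a::field ^ 'n ^ 'n, 'v::ab_group_add) crep \<Rightarrow>
   ('a ^ 'n ^ 'n, 'w::ab_group_add) crep \<Rightarrow> bool" where
  "rep_equiv R S \<longleftrightarrow>
     representation R \<and> representation S \<and>
     (\<exists>T. clinear_between R S T \<and> bij_betw T (space_of R) (space_of S) \<and>
          (\<forall>g\<in>GL. \<forall>x\<in>space_of R. T (act R g x) = act S g (T x)))"

definition contained_in ::
  "('a::field ^ 'n ^ 'n, 'v::ab_group_add) crep \<Rightarrow>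
   ('a ^ 'n ^ 'n, 'w::ab_group_add) crep \<Rightarrow> bool" where
  "contained_in R S \<longleftrightarrow>
     (\<exists>U. invariant_subspace S U \<and> rep_equiv R (S\<lparr>space_of := U\<rparr>))"


section \<open>Flags\<close>

text \<open>\<open>flags J\<close> is the set of flags containing one subspace \<open>V i\<close> of dimension \<open>i\<close> for each
  \<open>i \<in> J\<close>. Flags are extensional functions, so that equality of flags is equality of functions.\<close>

definition flags :: "nat set \<Rightarrow> (nat \<Rightarrow> ('a::field ^ 'n) set) set" where
  "flags J = {V \<in> extensional J.
     (\<forall>i\<in>J. vec.subspace (V i) \<and> vec.dim (V i) = i) \<and>
     (\<forall>i\<in>J. \<forall>j\<in>J. i \<le> j \<longrightarrow> V i \<subseteq> V j)}"

definition complete_flags :: "(nat \<Rightarrow> ('a::field ^ 'n) set) set" where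
  "complete_flags = flags {0..CARD('n)}"

definition flag_act ::
  "nat set \<Rightarrow> (nat \<Rightarrow> ('a::field ^ 'n) set) \<Rightarrow> 'a ^ 'n ^ 'n \<Rightarrow> (nat \<Rightarrow> ('a ^ 'n) set)" where
  "flag_act J V g = (\<lambda>i\<in>J. (\<lambda>x. x v* g) ` V i)"

text \<open>The permutation representation on the complex functions on \<open>flags J\<close>, which are encoded
  as functions vanishing outside \<open>flags J\<close>. Since \<open>V \<mapsto> V g\<close> is a right action,
  \<open>(g f) V = f (V g)\<close> is a left action; it maps the delta function at \<open>V\<close> to the delta
  function at \<open>V g\<inverse>\<close>.\<close>

definition perm_rep ::
  "nat set \<Rightarrow> ('a::field ^ 'n ^ 'n, (nat \<Rightarrow> ('a ^ 'n) set) \<Rightarrow> complex) crep" where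
  "perm_rep J =
     \<lparr>space_of = {f. \<forall>V. V \<notin> flags J \<longrightarrow> f V = 0},
      scale_of = (\<lambda>c f V. c * f V),
      act = (\<lambda>g f V. if V \<in> flags J then f (flag_act J V g) else 0)\<rparr>"

definition steinberg ::
  "('a::{field,finite} ^ 'n ^ 'n, 'v::ab_group_add) crep \<Rightarrow> bool" where
  "steinberg R \<longleftrightarrow>
     irreducible_rep R \<and>
     contained_in R
       (perm_rep {0..CARD('n)} :: ('a ^ 'n ^ 'n, (nat \<Rightarrow> ('a ^ 'n) set) \<Rightarrow> complex) crep) \<and>
     (\<forall>j\<in>{1..CARD('n) - 1}. \<not> contained_in R
       (perm_rep ({0..CARD('n)} - {j})
          :: ('a ^ 'n ^ 'n, (nat \<Rightarrow> ('a ^ 'n) set) \<Rightarrow> complex) crep))"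


section \<open>The space determined by the kernel\<close>

definition flag_k ::
  "(nat \<Rightarrow> ('a::field ^ 'n) set) \<Rightarrow> (nat \<Rightarrow> ('a ^ 'n) set) \<Rightarrow> nat" where
  "flag_k V W = card {(i, j). i < CARD('n) \<and> j < CARD('n) \<and>
     vec.dim (V i \<inter> W j) = vec.dim (V (i + 1) \<inter> W (j + 1))}"

definition flag_kernel ::
  "(nat \<Rightarrow> ('a::{field,finite} ^ 'n) set) \<Rightarrow> (nat \<Rightarrow> ('a ^ 'n) set) \<Rightarrow> complex" where
  "flag_kernel V W = (- of_nat CARD('a)) powi (- int (flag_k V W))"

definition complex_inner_product ::
  "('g, 'v::ab_group_add) crep \<Rightarrow> ('v \<Rightarrow> 'v \<Rightarrow> complex) \<Rightarrow> bool" where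
  "complex_inner_product R ip \<longleftrightarrow>
     (\<forall>x\<in>space_of R. \<forall>y\<in>space_of R. \<forall>z\<in>space_of R. ip (x + y) z = ip x z + ip y z) \<and>
     (\<forall>c. \<forall>x\<in>space_of R. \<forall>y\<in>space_of R. ip (scale_of R c x) y = c * ip x y) \<and>
     (\<forall>x\<in>space_of R. \<forall>y\<in>space_of R. ip y x = cnj (ip x y)) \<and>
     (\<forall>x\<in>space_of R. x \<noteq> 0 \<longrightarrow> Re (ip x x) > 0)"

text \<open>\<open>kernel_rep K R ip \<phi>\<close>: the space of \<open>R\<close> with inner product \<open>ip\<close> is spanned by vectors
  \<open>\<phi> V\<close>, indexed by the complete flags, with Gram matrix \<open>K\<close>, and \<open>R\<close> is a unitary
  representation permuting them. As for \<^const>\<open>perm_rep\<close>, \<open>g\<close> maps \<open>\<phi> V\<close> to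
  \<open>\<phi> (V g\<inverse>)\<close>, which makes the action a left action.\<close>

definition kernel_rep ::
  "((nat \<Rightarrow> ('a::field ^ 'n) set) \<Rightarrow> (nat \<Rightarrow> ('a ^ 'n) set) \<Rightarrow> complex) \<Rightarrow>
   ('a ^ 'n ^ 'n, 'v::ab_group_add) crep \<Rightarrow> ('v \<Rightarrow> 'v \<Rightarrow> complex) \<Rightarrow>
   ((nat \<Rightarrow> ('a ^ 'n) set) \<Rightarrow> 'v) \<Rightarrow> bool" where
  "kernel_rep K R ip \<phi> \<longleftrightarrow>
     representation R \<and>
     complex_inner_product R ip \<and>
     space_of R = module.span (scale_of R) (\<phi> ` complete_flags) \<and>
     (\<forall>V\<in>complete_flags. \<forall>W\<in>complete_flags. ip (\<phi> V) (\<phi> W) = K V W) \<and>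
     (\<forall>g\<in>GL. \<forall>x\<in>space_of R. \<forall>y\<in>space_of R. ip (act R g x) (act R g y) = ip x y) \<and>
     (\<forall>g\<in>GL. \<forall>V\<in>complete_flags.
        act R g (\<phi> V) = \<phi> (flag_act {0..CARD('n)} V (matrix_inv g)))"

end

theory Submission
  imports Defs
begin

text \<open>Let \<open>N\<close> be the space of functions on \<open>Fl(n)\<close> whose sums over all panels (the \<open>q + 1\<close> flags
  that agree off one index \<open>j\<close>) vanish, that is, the common kernel of the maps to \<open>\<ell>\<^sub>2(Fl\<^sub>j(n))\<close>.
  Relative to a flag \<open>W\<close>, a panel consists of one flag \<open>V\<^sub>0\<close> with minimal \<open>k(V\<^sub>0, W)\<close> and \<open>q\<close>
  flags on which \<open>k(\<cdot>, W)\<close> is larger by 1, permuted transitively by the stabilizer of \<open>W\<close>. Hence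
  \<open>K(\<cdot>, W)\<close> lies in \<open>N\<close>, and it is, up to scalars, the only function in \<open>N\<close> that is invariant
  under that stabilizer. Averaging over the stabilizer shows that every nonzero invariant
  subspace of \<open>N\<close> contains all \<open>K(\<cdot>, W)\<close>, so their span is the only irreducible invariant
  subspace of \<open>N\<close>. It is isomorphic to \<open>H\<^sub>n\<close> through \<open>x \<mapsto> (V \<mapsto> \<langle>x, \<phi>\<^sub>V\<rangle>)\<close>.\<close>

subsection \<open>Linear algebra over a field\<close>

text \<open>The constant \<open>-q\<close> is forced: on a panel, a value \<open>x\<close> at the
  flag nearest to \<open>W\<close> and \<open>q\<close> equal values at the others sum to zero only
  if each of these is \<open>-x/q\<close>. Every flag other than \<open>W\<close> is one of the
  \<open>q\<close> far flags of some panel, so a function in \<open>N\<close> that is invariant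
  under the stabilizer of \<open>W\<close> can be traced back to its value at \<open>W\<close> by
  lowering \<open>k\<close>.

  The definition of the Steinberg representation speaks of all embeddings into functions on
  \<open>Fl_j(n)\<close>, whereas \<open>N\<close> is cut out by the particular maps that sum over
  panels; the two have to be compared in both directions. If an irreducible subspace of the
  functions on \<open>Fl(n)\<close> embeds in no space of functions on \<open>Fl_j(n)\<close>, each
  summation map is zero or injective on it, hence zero, and the subspace lies in \<open>N\<close>.
  Conversely, an arbitrary embedding of \<open>H_n\<close> has to be excluded: by uniqueness in
  \<open>N\<close> it is given by multiples of \<open>K\<close>, and its values at two flags of one
  panel would determine each other through a factor of modulus below 1.\<close>

lemma span_insert_subspace_iff:
  fixes A :: "('a::field ^ 'n) set"
  assumes "vec.subspace A"
  shows "x \<in> vec.span (insert a A) \<longleftrightarrow> (\<exists>c. x - c *s a \<in> A)"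
  using assms by (simp add: vec.span_breakdown_eq vec.span_eq_iff[THEN iffD2])

lemma dim_span_insert_subspace:
  fixes A :: "('a::field ^ 'n) set"
  assumes "vec.subspace A" "a \<notin> A"
  shows "vec.dim (vec.span (insert a A)) = Suc (vec.dim A)"
  using assms by (simp add: vec.dim_insert vec.span_eq_iff[THEN iffD2])

lemma span_insert_eq_subspace:
  fixes A :: "('a::field ^ 'n) set"
  assumes "vec.subspace A" "vec.subspace U" "A \<subseteq> U" "a \<in> U" "a \<notin> A" "vec.dim U \<le> Suc (vec.dim A)"
  shows "vec.span (insert a A) = U"
proof (rule vec.subspace_dim_equal)
  show "vec.span (insert a A) \<subseteq> U"
    using assms by (intro vec.span_minimal) auto
  show "vec.dim U \<le> vec.dim (vec.span (insert a A))"
    using assms dim_span_insert_subspace by metis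
qed (use assms in auto)

lemma subspace_scaleD:
  fixes S :: "('a::field ^ 'n) set"
  assumes "vec.subspace S" "c *s x \<in> S" "c \<noteq> 0"
  shows "x \<in> S"
proof -
  have "inverse c *s (c *s x) = x" using assms by simp
  then show ?thesis using vec.subspace_scale[OF assms(1,2), of "inverse c"] by metis
qed

text \<open>The map has rank at most one, with range in the line of \<open>a\<close>. When
  \<open>a\<close> also lies in \<open>D\<close> it squares to zero, so adding multiples of it to
  the identity gives transvections, the group elements that move the flags of a panel.\<close>

lemma shear_exists:
  fixes D :: "('a::field ^ 'n) set"
  assumes "vec.subspace D" "b \<notin> D"
  obtains h where "Vector_Spaces.linear (*s) (*s) h" "\<And>x. x \<in> D \<Longrightarrow> h x = 0" "h b = a"
    "\<And>x. \<exists>c. h x = c *s a"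
proof -
  obtain B where B: "B \<subseteq> D" "vec.independent B" "D \<subseteq> vec.span B"
    using vec.maximal_independent_subset by blast
  have sp: "vec.span B = D"
    using B assms(1) by (metis vec.span_minimal subset_antisym)
  have ind: "vec.independent (insert b B)"
    using B assms sp by (intro vec.independent_insertI) auto
  \<comment> \<open>This form of the extension theorem keeps the range inside the span of the
    prescribed values \<open>0\<close> and \<open>a\<close>; vanishing on \<open>D\<close> and the
    value at \<open>b\<close> alone would not control \<open>h\<close> elsewhere.\<close>
  obtain h where h: "Vector_Spaces.linear (*s) (*s) h"
    "\<forall>x\<in>insert b B. h x = (if x = b then a else 0)"
    "range h = vec.span ((\<lambda>x. if x = b then a else 0) ` insert b B)"
    using vec.linear_independent_extend_subspace[OF ind, of "\<lambda>x. if x = b then a else 0"] by blast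
  have "b \<notin> B" using B assms by auto
  show thesis
  proof
    show "Vector_Spaces.linear (*s) (*s) h" by fact
    show "h b = a" using h by auto
    fix x
    show "h x = 0" if "x \<in> D"
    proof (rule vec.linear_eq_0_on_span[OF h(1)])
      show "x \<in> vec.span B" using that sp by simp
      show "\<And>x. x \<in> B \<Longrightarrow> h x = 0" using h(2) \<open>b \<notin> B\<close> by auto
    qed
    have "h x \<in> vec.span ((\<lambda>x. if x = b then a else 0) ` insert b B)"
      using h(3) by blast
    moreover have "\<dots> \<subseteq> vec.span {0, a}"
      by (intro vec.span_mono) auto
    moreover have "vec.span {0, a} = range (\<lambda>c. c *s a)"
      by (simp add: vec.span_insert_0 vec.span_singleton)
    ultimately show "\<exists>c. h x = c *s a" by blast
  qed
qed

text \<open>Since \<open>h\<close> squares to zero, \<open>x + c *s h x\<close> is inverted by the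
  same formula with \<open>- c\<close>. The transpose appears because matrices act on row vectors
  from the right.\<close>

lemma shear_matrix:
  fixes h :: "'a::field ^ 'n \<Rightarrow> 'a ^ 'n"
  assumes "Vector_Spaces.linear (*s) (*s) h" "\<And>x. h (h x) = 0"
  obtains g where "g \<in> GL" "\<And>x. x v* g = x + c *s h x"
proof -
  interpret h: Vector_Spaces.linear "(*s)" "(*s)" h by fact
  define f where "f d x = x + d *s h x" for d x
  have lin: "Vector_Spaces.linear (*s) (*s) (f d)" for d
    by unfold_locales (auto simp: f_def h.add h.scale vec.scale_right_distrib algebra_simps)
  have mv: "x v* transpose (matrix (f d)) = f d x" for d x
    using matrix_works[OF lin] by simp
  have "f d (f (- d) x) = x" for d x
    by (simp add: f_def h.add h.scale h.diff h.neg assms(2) algebra_simps)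
  then have "matrix (f d) ** matrix (f (- d)) = mat 1" for d
    by (simp add: matrix_eq matrix_vector_mul_assoc[symmetric] matrix_works[OF lin])
  then have inv: "transpose (matrix (f (- d))) ** transpose (matrix (f d)) = mat 1" for d
    by (metis matrix_transpose_mul transpose_mat)
  have "transpose (matrix (f c)) \<in> GL"
    unfolding GL_def mem_Collect_eq invertible_left_inverse using inv by blast
  then show thesis
    using mv that by (auto simp: f_def)
qed

lemma shear_image_subspace:
  fixes S :: "('a::field ^ 'n) set"
  assumes "Vector_Spaces.linear (*s) (*s) h" "\<And>x. h (h x) = 0" "vec.subspace S" "h ` S \<subseteq> S"
  shows "(\<lambda>x. x + c *s h x) ` S = S"
proof
  interpret h: Vector_Spaces.linear "(*s)" "(*s)" h by fact
  have mem: "x + d *s h x \<in> S" if "x \<in> S" for x d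
    using that assms(3,4) by (auto intro!: vec.subspace_add vec.subspace_scale)
  show "(\<lambda>x. x + c *s h x) ` S \<subseteq> S" using mem by auto
  show "S \<subseteq> (\<lambda>x. x + c *s h x) ` S"
  proof
    fix x assume "x \<in> S"
    then have "x + (- c) *s h x \<in> S" by (rule mem)
    moreover have "x = (x + (- c) *s h x) + c *s h (x + (- c) *s h x)"
      by (simp add: h.add h.scale h.diff h.neg assms(2))
    ultimately show "x \<in> (\<lambda>x. x + c *s h x) ` S" by (rule rev_image_eqI)
  qed
qed

subsection \<open>Complete flags and panels\<close>

lemma
  fixes V :: "nat \<Rightarrow> ('a::field ^ 'n) set"
  assumes "V \<in> complete_flags"
  shows complete_flags_subspace: "i \<le> CARD('n) \<Longrightarrow> vec.subspace (V i)"
    and complete_flags_dim: "i \<le> CARD('n) \<Longrightarrow> vec.dim (V i) = i"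
    and complete_flags_mono: "i \<le> j \<Longrightarrow> j \<le> CARD('n) \<Longrightarrow> V i \<subseteq> V j"
    and complete_flags_ext: "V \<in> extensional {0..CARD('n)}"
  using assms by (auto simp: complete_flags_def flags_def)

lemma complete_flags_0:
  fixes V :: "nat \<Rightarrow> ('a::field ^ 'n) set"
  assumes "V \<in> complete_flags"
  shows "V 0 = {0}"
  using complete_flags_dim[OF assms, of 0] complete_flags_subspace[OF assms, of 0] vec.subspace_0
  by auto

lemma complete_flags_top:
  fixes V :: "nat \<Rightarrow> ('a::field ^ 'n) set"
  assumes "V \<in> complete_flags"
  shows "V (CARD('n)) = UNIV"
  by (rule vec.subspace_dim_equal)
    (use assms complete_flags_dim[OF assms, of "CARD('n)"] complete_flags_subspace[OF assms]
      in \<open>auto simp: vec_dim_card simp del: vec.dim_UNIV\<close>)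

lemma complete_flags_strict:
  fixes V :: "nat \<Rightarrow> ('a::field ^ 'n) set"
  assumes "V \<in> complete_flags" "i < j" "j \<le> CARD('n)"
  shows "\<not> V j \<subseteq> V i"
  using vec.dim_subset[of "V j" "V i"] complete_flags_dim[OF assms(1)] assms by auto

text \<open>\<open>J\<close> is arbitrary: the dimension bound shows that a flag exists only if all
  indices are at most \<open>n\<close>, so each flag is recovered from finitely many subsets of a
  finite space.\<close>

lemma finite_flags: "finite (flags J :: (nat \<Rightarrow> ('a::{field,finite} ^ 'n) set) set)"
proof -
  have "flags J \<subseteq> (\<lambda>f. restrict (\<lambda>i. f i) J) ` ({..CARD('n)} \<rightarrow>\<^sub>E (UNIV :: ('a^'n) set set))"
  proof
    fix V :: "nat \<Rightarrow> ('a ^ 'n) set" assume V: "V \<in> flags J"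
    have "V = restrict (restrict V {..CARD('n)}) J"
    proof
      fix i
      have "i \<le> CARD('n)" if "i \<in> J"
        using V that vec.dim_subset_UNIV[of "V i"]
        by (auto simp: flags_def vec.dimension_def card_cart_basis)
      then show "V i = restrict (restrict V {..CARD('n)}) J i"
        using V by (auto simp: flags_def extensional_def)
    qed
    moreover have "restrict V {..CARD('n)} \<in> {..CARD('n)} \<rightarrow>\<^sub>E UNIV" by auto
    ultimately show "V \<in> (\<lambda>f. restrict (\<lambda>i. f i) J) ` ({..CARD('n)} \<rightarrow>\<^sub>E UNIV)" by blast
  qed
  then show ?thesis
    by (rule finite_subset) (intro finite_imageI finite_PiE, auto)
qed

lemma finite_complete_flags: "finite (complete_flags :: (nat \<Rightarrow> ('a::{field,finite} ^ 'n) set) set)"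
  unfolding complete_flags_def by (rule finite_flags)

section \<open>The action of the general linear group on flags\<close>

lemma vector_matrix_mult_inj:
  fixes g :: "'a::field ^ 'n ^ 'n"
  assumes "g \<in> GL"
  shows "inj (\<lambda>x. x v* g)"
proof -
  obtain h where "g ** h = mat 1" using assms by (auto simp: GL_def invertible_def)
  then have "(x v* g) v* h = x" for x
    by (simp add: vector_matrix_mul_assoc)
  then show ?thesis by (metis injI)
qed

lemma linear_vector_matrix_mult: "Vector_Spaces.linear (*s) (*s) (\<lambda>x. x v* (g :: 'a::field ^ 'n ^ 'n))"
  by (metis (no_types, lifting) ext matrix_vector_mul_linear_gen transpose_matrix_vector)

lemma flag_act_in_flags:
  fixes V :: "nat \<Rightarrow> ('a::field ^ 'n) set"
  assumes "V \<in> flags J" "g \<in> GL"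
  shows "flag_act J V g \<in> flags J"
proof -
  have "vec.subspace ((\<lambda>x. x v* g) ` V i)" if "i \<in> J" for i
    using assms that by (auto simp: flags_def intro: vec.linear_subspace_image[OF linear_vector_matrix_mult])
  moreover have "vec.dim ((\<lambda>x. x v* g) ` V i) = i" if "i \<in> J" for i
    using assms that
    by (subst vec.dim_image_eq[OF linear_vector_matrix_mult])
       (auto simp: flags_def intro: inj_on_subset[OF vector_matrix_mult_inj])
  ultimately show ?thesis
    using assms by (fastforce simp: flags_def flag_act_def)
qed

lemma flag_act_mult: "flag_act J (flag_act J V g) h = flag_act J V (g ** h)"
  by (auto simp: flag_act_def image_image vector_matrix_mul_assoc fun_eq_iff)

lemma flag_act_one: "V \<in> extensional J \<Longrightarrow> flag_act J V (mat 1) = V"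
  by (auto simp: flag_act_def fun_eq_iff extensional_def)

text \<open>The fibre through \<open>V\<close> of the map that forgets the subspace of dimension
  \<open>j\<close>. For a complete flag and \<open>0 < j < n\<close> it corresponds to the lines of
  the plane \<open>V (j + 1) / V (j - 1)\<close>.\<close>

definition panel :: "nat \<Rightarrow> (nat \<Rightarrow> ('a::field ^ 'n) set) \<Rightarrow> (nat \<Rightarrow> ('a ^ 'n) set) set" where
  "panel j V = {V' \<in> complete_flags. \<forall>i. i \<noteq> j \<longrightarrow> V' i = V i}"

text \<open>The new subspace has to be compared only with its two neighbours; monotonicity does the
  rest. Starting from an incomplete flag serves both to move within a panel and to complete a flag
  of \<open>Fl_j(n)\<close>.\<close>

lemma flag_update:
  fixes V :: "nat \<Rightarrow> ('a::field ^ 'n) set"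
  assumes "V \<in> flags ({0..CARD('n)} - {Suc i})" "Suc i < CARD('n)" "vec.subspace U" "vec.dim U = Suc i"
    "V i \<subseteq> U" "U \<subseteq> V (Suc (Suc i))"
  shows "V(Suc i := U) \<in> complete_flags"
proof -
  have mono: "V k \<subseteq> V l" if "k \<le> l" "k \<noteq> Suc i" "l \<noteq> Suc i" "l \<le> CARD('n)" for k l
    using assms(1) that by (auto simp: flags_def)
  have "V k \<subseteq> U" if "k \<le> Suc i" "k \<noteq> Suc i" for k
    using mono[of k i] that assms by auto
  moreover have "U \<subseteq> V l" if "Suc i \<le> l" "l \<noteq> Suc i" "l \<le> CARD('n)" for l
    using mono[of "Suc (Suc i)" l] that assms by auto
  ultimately show ?thesis
    using assms mono by (auto simp: complete_flags_def flags_def extensional_def)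
qed

lemma complete_flags_restrict:
  fixes V :: "nat \<Rightarrow> ('a::field ^ 'n) set"
  assumes "V \<in> complete_flags"
  shows "restrict V ({0..CARD('n)} - {j}) \<in> flags ({0..CARD('n)} - {j})"
  using assms by (auto simp: complete_flags_def flags_def)

lemma complete_flags_update:
  fixes V :: "nat \<Rightarrow> ('a::field ^ 'n) set"
  assumes "V \<in> complete_flags" "Suc i < CARD('n)" "vec.subspace U" "vec.dim U = Suc i"
    "V i \<subseteq> U" "U \<subseteq> V (Suc (Suc i))"
  shows "V(Suc i := U) \<in> complete_flags"
proof -
  have "(restrict V ({0..CARD('n)} - {Suc i}))(Suc i := U) \<in> complete_flags"
    using assms by (intro flag_update complete_flags_restrict) auto
  also have "(restrict V ({0..CARD('n)} - {Suc i}))(Suc i := U) = V(Suc i := U)"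
    using complete_flags_ext[OF assms(1)] by (auto simp: fun_eq_iff extensional_def)
  finally show ?thesis .
qed

text \<open>\<open>Suc m\<close> and \<open>Suc m'\<close> are the two indices at which the filtration that \<open>W\<close> induces
  on the plane \<open>C / A\<close> jumps.\<close>

lemma jumps_exist:
  fixes W :: "nat \<Rightarrow> ('a::field ^ 'n) set"
  assumes W: "W \<in> complete_flags" and A: "vec.subspace A" and C: "vec.subspace C"
    and AC: "A \<subseteq> C" and dimC: "vec.dim C = Suc (Suc (vec.dim A))"
  obtains m m' a b where "m < m'" "m' < CARD('n)"
    "a \<in> C" "a \<in> W (Suc m)" "a \<notin> A" "C \<inter> W m \<subseteq> A"
    "b \<in> C" "b \<in> W (Suc m')" "b \<notin> vec.span (insert a A)" "C \<inter> W m' \<subseteq> vec.span (insert a A)"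
proof -
  \<comment> \<open>The first \<open>l\<close> at which \<open>C \<inter> W l\<close> leaves
    \<open>B\<close> is positive, because \<open>W 0\<close> is zero, and at most \<open>n\<close>,
    because \<open>W n\<close> is the whole space; \<open>m\<close> is its predecessor.\<close>
  have jump: "\<exists>m<CARD('n). C \<inter> W m \<subseteq> B \<and> \<not> C \<inter> W (Suc m) \<subseteq> B"
    if B: "vec.subspace B" "\<not> C \<subseteq> B" for B
  proof -
    define l where "l = (LEAST l. \<not> C \<inter> W l \<subseteq> B)"
    have "\<not> C \<inter> W (CARD('n)) \<subseteq> B" using B complete_flags_top[OF W] by auto
    then have 1: "\<not> C \<inter> W l \<subseteq> B" "l \<le> CARD('n)"
      unfolding l_def by (metis (mono_tags, lifting) LeastI, metis (mono_tags, lifting) Least_le)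
    have "l \<noteq> 0" using 1 complete_flags_0[OF W] vec.subspace_0[OF B(1)] by (metis inf.cobounded2 insert_subset order_trans empty_subsetI)
    then obtain m where m: "l = Suc m" by (cases l) auto
    have "C \<inter> W m \<subseteq> B"
      using not_less_Least[of m "\<lambda>l. \<not> C \<inter> W l \<subseteq> B"] m unfolding l_def by auto
    then show ?thesis using 1 m by (metis Suc_le_eq)
  qed
  have "\<not> C \<subseteq> A" using vec.dim_subset[of C A] dimC by auto
  then obtain m where m: "m < CARD('n)" "C \<inter> W m \<subseteq> A" "\<not> C \<inter> W (Suc m) \<subseteq> A"
    using jump[OF A] by blast
  then obtain a where a: "a \<in> C" "a \<in> W (Suc m)" "a \<notin> A" by auto
  define L where "L = vec.span (insert a A)"
  have L: "vec.subspace L" "vec.dim L = Suc (vec.dim A)"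
    unfolding L_def using dim_span_insert_subspace[OF A a(3)] by auto
  have AL: "A \<subseteq> L" "a \<in> L" unfolding L_def using vec.span_superset by blast+
  have "\<not> C \<subseteq> L" using vec.dim_subset[of C L] dimC L by auto
  then obtain m' where m': "m' < CARD('n)" "C \<inter> W m' \<subseteq> L" "\<not> C \<inter> W (Suc m') \<subseteq> L"
    using jump[OF L(1)] by blast
  then obtain b where b: "b \<in> C" "b \<in> W (Suc m')" "b \<notin> L" by auto
  have aWm: "a \<notin> W m" using a m by auto
  \<comment> \<open>Passing from \<open>W m\<close> to \<open>W (Suc m)\<close> adds only the vector
    \<open>a\<close>, so modulo \<open>A\<close> the trace on \<open>C\<close> grows by no more than
    the line of \<open>a\<close>. The second jump therefore comes strictly later.\<close>
  have CL: "C \<inter> W (Suc m) \<subseteq> L"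
  proof
    fix x assume x: "x \<in> C \<inter> W (Suc m)"
    have "vec.span (insert a (W m)) = W (Suc m)"
      using a aWm m W by (intro span_insert_eq_subspace) 
       (auto simp: complete_flags_subspace complete_flags_dim complete_flags_mono intro: complete_flags_mono[THEN subsetD])
    then obtain c where "x - c *s a \<in> W m"
      using span_insert_subspace_iff[of "W m" x a] x m W by (auto simp: complete_flags_subspace)
    moreover have "x - c *s a \<in> C"
      using x a C by (auto intro!: vec.subspace_diff vec.subspace_scale)
    ultimately have "x - c *s a \<in> A" using m by auto
    then show "x \<in> L" unfolding L_def using span_insert_subspace_iff[OF A] by blast
  qed
  have "m < m'"
  proof (rule ccontr)
    assume "\<not> m < m'"
    then have "W (Suc m') \<subseteq> W (Suc m)" using m by (intro complete_flags_mono[OF W]) auto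
    then show False using CL m' by auto
  qed
  then show thesis
    using that m a m' b unfolding L_def by blast
qed

text \<open>The two intersections are nested, so equality of dimensions amounts to the reverse
  inclusion. Counting row by row in \<open>i\<close> isolates the effect of changing one subspace of
  \<open>V\<close>: only two rows see it.\<close>

lemma flag_k_eq_sum:
  fixes V W :: "nat \<Rightarrow> ('a::field ^ 'n) set"
  assumes V: "V \<in> complete_flags" and W: "W \<in> complete_flags"
  shows "flag_k V W =
    (\<Sum>i<CARD('n). card {l. l < CARD('n) \<and> V (Suc i) \<inter> W (Suc l) \<subseteq> V i \<inter> W l})"
proof -
  have "vec.dim (V i \<inter> W l) = vec.dim (V (i + 1) \<inter> W (l + 1)) \<longleftrightarrow>
      V (Suc i) \<inter> W (Suc l) \<subseteq> V i \<inter> W l" if "i < CARD('n)" "l < CARD('n)" for i l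
  proof
    have sub: "V i \<inter> W l \<subseteq> V (Suc i) \<inter> W (Suc l)"
      using that complete_flags_mono[OF V, of i "Suc i"] complete_flags_mono[OF W, of l "Suc l"] by auto
    show "V (Suc i) \<inter> W (Suc l) \<subseteq> V i \<inter> W l"
      if "vec.dim (V i \<inter> W l) = vec.dim (V (i + 1) \<inter> W (l + 1))"
      using vec.subspace_dim_equal[OF _ _ sub] \<open>i < _\<close> \<open>l < _\<close> that V W
      by (auto simp: complete_flags_subspace vec.subspace_inter)
    show "vec.dim (V i \<inter> W l) = vec.dim (V (i + 1) \<inter> W (l + 1))"
      if "V (Suc i) \<inter> W (Suc l) \<subseteq> V i \<inter> W l"
      using that sub by (metis Suc_eq_plus1 subset_antisym)
  qed
  then have "{(i, j). i < CARD('n) \<and> j < CARD('n) \<and>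
     vec.dim (V i \<inter> W j) = vec.dim (V (i + 1) \<inter> W (j + 1))} =
    (SIGMA i:{..<CARD('n)}. {l. l < CARD('n) \<and> V (Suc i) \<inter> W (Suc l) \<subseteq> V i \<inter> W l})"
    by auto
  then show ?thesis
    unfolding flag_k_def by simp
qed

lemma flag_k_commute: "flag_k V W = flag_k W V"
  unfolding flag_k_def
  by (rule bij_betw_same_card[where f = "\<lambda>(i, j). (j, i)"])
     (auto simp: bij_betw_def inj_on_def Int_commute image_iff)

lemma flag_k_self:
  fixes V :: "nat \<Rightarrow> ('a::field ^ 'n) set"
  assumes "V \<in> complete_flags"
  shows "flag_k V V = 0"
proof -
  have "\<not> V (Suc i) \<inter> V (Suc l) \<subseteq> V i \<inter> V l" if "i < CARD('n)" "l < CARD('n)" for i l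
  proof (cases "i \<le> l")
    case True
    then have "V (Suc i) \<inter> V (Suc l) = V (Suc i)"
      using that complete_flags_mono[OF assms, of "Suc i" "Suc l"] by auto
    then show ?thesis using complete_flags_strict[OF assms, of i "Suc i"] that by auto
  next
    case False
    then have "V (Suc i) \<inter> V (Suc l) = V (Suc l)"
      using that complete_flags_mono[OF assms, of "Suc l" "Suc i"] by auto
    then show ?thesis using complete_flags_strict[OF assms, of l "Suc l"] that by auto
  qed
  then show ?thesis by (simp add: flag_k_eq_sum[OF assms assms])
qed

text \<open>\<open>V0\<close> is the flag of the panel closest to \<open>W\<close>; the last property says that \<open>V0\<close> has no
  descent at \<open>Suc i\<close> with respect to \<open>W\<close>.\<close>

lemma panel_structure:
  fixes V W :: "nat \<Rightarrow> ('a::{field,finite} ^ 'n) set"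
  assumes V: "V \<in> complete_flags" and W: "W \<in> complete_flags" and i: "Suc i < CARD('n)"
  obtains V0 R where "panel (Suc i) V = insert V0 R" "V0 \<notin> R" "card R = CARD('a)"
    "\<And>V'. V' \<in> R \<Longrightarrow> flag_k V' W = Suc (flag_k V0 W)"
    "\<And>V' V''. V' \<in> R \<Longrightarrow> V'' \<in> R \<Longrightarrow>
       \<exists>g\<in>GL. flag_act {0..CARD('n)} W g = W \<and> flag_act {0..CARD('n)} V' g = V''"
    "\<And>l. l \<le> CARD('n) \<Longrightarrow> \<not> V0 (Suc (Suc i)) \<inter> W l \<subseteq> V0 (Suc i) \<Longrightarrow>
       \<exists>l'<l. \<not> V0 (Suc i) \<inter> W l' \<subseteq> V0 i"
proof -
  define A C where "A = V i" and "C = V (Suc (Suc i))"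
  have A: "vec.subspace A" "vec.dim A = i" and C: "vec.subspace C" "vec.dim C = Suc (Suc i)"
    using V i by (auto simp: A_def C_def complete_flags_subspace complete_flags_dim)
  have AC: "A \<subseteq> C" unfolding A_def C_def using complete_flags_mono[OF V] i by auto
  obtain m m' a b where mm: "m < m'" "m' < CARD('n)"
    and a: "a \<in> C" "a \<in> W (Suc m)" "a \<notin> A" and Wm: "C \<inter> W m \<subseteq> A"
    and b: "b \<in> C" "b \<in> W (Suc m')" "b \<notin> vec.span (insert a A)"
    and Wm': "C \<inter> W m' \<subseteq> vec.span (insert a A)"
    using jumps_exist[OF W A(1) C(1) AC] A C by metis
  have Wsub: "vec.subspace (W l)" if "l \<le> CARD('n)" for l
    using W that by (rule complete_flags_subspace)
  have Wmono: "x \<in> W k \<Longrightarrow> k \<le> l \<Longrightarrow> l \<le> CARD('n) \<Longrightarrow> x \<in> W l" for x k l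
    using complete_flags_mono[OF W] by blast
  \<comment> \<open>The lines of the plane \<open>C / A\<close> are the line of \<open>a\<close>,
    where the filtration induced by \<open>W\<close> jumps first, and the lines of
    \<open>b + t *s a\<close> with \<open>t\<close> in the field. They give the flag
    \<open>V0\<close> and the \<open>q\<close> flags \<open>F t\<close>.\<close>
  define L where "L = vec.span (insert a A)"
  define U where "U t = vec.span (insert (b + t *s a) A)" for t
  define F where "F t = V(Suc i := U t)" for t
  define V0 where "V0 = V(Suc i := L)"
  note spA = span_insert_subspace_iff[OF A(1)]
  have L: "vec.subspace L" "vec.dim L = Suc i" "L \<subseteq> C" "A \<subseteq> L" "a \<in> L"
    using A C AC a dim_span_insert_subspace[OF A(1) a(3)] vec.span_minimal[of "insert a A" C]
      vec.span_superset[of "insert a A"]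
    by (simp_all add: L_def)
  have bt: "b + t *s a \<in> C" "b + t *s a \<notin> L" "b + t *s a \<in> W (Suc m')" for t
  proof -
    show "b + t *s a \<in> C" using a b C by (auto intro!: vec.subspace_add vec.subspace_scale)
    have "a \<in> W (Suc m')" using a mm Wmono by auto
    then show "b + t *s a \<in> W (Suc m')"
      using b mm Wsub by (auto intro!: vec.subspace_add vec.subspace_scale)
    show "b + t *s a \<notin> L"
    proof
      assume "b + t *s a \<in> L"
      then have "b + t *s a - t *s a \<in> L" using L by (intro vec.subspace_diff vec.subspace_scale)
      then show False using b L_def by simp
    qed
  qed
  have btA: "b + t *s a \<notin> A" for t using bt L by auto
  have U: "vec.subspace (U t)" "vec.dim (U t) = Suc i" "U t \<subseteq> C" "A \<subseteq> U t" "b + t *s a \<in> U t" for t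
    using A C AC bt dim_span_insert_subspace[OF A(1) btA] vec.span_minimal[of "insert (b + t *s a) A" C]
      vec.span_superset[of "insert (b + t *s a) A"]
    by (simp_all add: U_def)
  have UL: "U t \<inter> L \<subseteq> A" for t
  proof
    fix x assume x: "x \<in> U t \<inter> L"
    then obtain c where c: "x - c *s (b + t *s a) \<in> A"
      unfolding U_def Int_iff spA by blast
    define p where "p = b + t *s a"
    have p: "x - c *s p \<in> A" "p \<notin> L" using c bt by (simp_all only: p_def not_False_eq_True)
    then have "x - (x - c *s p) \<in> L" using x L vec.subspace_diff[OF L(1), of x "x - c *s p"] by blast
    then have *: "c *s p \<in> L" by (simp add: diff_diff_eq2)
    then have "c = 0" using subspace_scaleD[OF L(1)] p by blast
    then show "x \<in> A" using c by simp
  qed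
  have FX: "F t \<in> complete_flags" for t
    unfolding F_def using V i U A_def C_def by (intro complete_flags_update) auto
  have V0X: "V0 \<in> complete_flags"
    unfolding V0_def using V i L A_def C_def by (intro complete_flags_update) auto
  have injF: "inj F"
  proof
    fix s t assume "F s = F t"
    then have eq: "U s = U t" unfolding F_def by (metis fun_upd_same)
    have "b + s *s a - (b + t *s a) \<in> U t" using U(1,5) eq by (metis vec.subspace_diff)
    then have *: "(s - t) *s a \<in> U t" by (simp add: vec.scale_left_diff_distrib)
    show "s = t"
    proof (rule ccontr)
      assume "s \<noteq> t"
      then have "a \<in> U t" using subspace_scaleD[OF U(1) *] by simp
      then show False using UL L a by blast
    qed
  qed
  have V0F: "V0 \<noteq> F t" for t
  proof
    assume "V0 = F t"
    then have "L = U t" unfolding F_def V0_def by (metis fun_upd_same)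
    then show False using bt U by blast
  qed
  have panelF: "panel (Suc i) V = insert V0 (range F)"
  proof
    show "insert V0 (range F) \<subseteq> panel (Suc i) V"
      using FX V0X by (auto simp: panel_def F_def V0_def)
    show "panel (Suc i) V \<subseteq> insert V0 (range F)"
    proof
      fix V' assume "V' \<in> panel (Suc i) V"
      then have V': "V' \<in> complete_flags" "\<And>k. k \<noteq> Suc i \<Longrightarrow> V' k = V k"
        by (auto simp: panel_def)
      define Q where "Q = V' (Suc i)"
      have V'eq: "V' = V(Suc i := Q)" using V'(2) by (auto simp: Q_def fun_eq_iff)
      have Q: "vec.subspace Q" "vec.dim Q = Suc i" "A \<subseteq> Q" "Q \<subseteq> C"
        using i complete_flags_subspace[OF V'(1)] complete_flags_dim[OF V'(1)]
          complete_flags_mono[OF V'(1), of i "Suc i"] complete_flags_mono[OF V'(1), of "Suc i" "Suc (Suc i)"] V'(2)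
        by (auto simp: Q_def A_def C_def)
      show "V' \<in> insert V0 (range F)"
      proof (cases "Q \<subseteq> L")
        case True
        then have "Q = L" using vec.subspace_dim_equal[OF Q(1) L(1)] Q L by simp
        then show ?thesis using V'eq V0_def by auto
      next
        case False
        then obtain x where x: "x \<in> Q" "x \<notin> L" by auto
        have "vec.span (insert b L) = C"
          by (rule span_insert_eq_subspace) (use L C b L_def in auto)
        then obtain c where "x - c *s b \<in> L"
          using x Q span_insert_subspace_iff[OF L(1), of x b] by auto
        moreover from this obtain d where d: "x - c *s b - d *s a \<in> A"
          unfolding L_def spA by auto
        ultimately have "c \<noteq> 0" using x by (metis vec.scale_zero_left diff_zero)
        have "x - (x - c *s b - d *s a) \<in> Q"
          using vec.subspace_diff[OF Q(1) x(1), of "x - c *s b - d *s a"] d Q(3) by blast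
        then have "inverse c *s (x - (x - c *s b - d *s a)) \<in> Q" by (rule vec.subspace_scale[OF Q(1)])
        also have "inverse c *s (x - (x - c *s b - d *s a)) = b + (inverse c * d) *s a"
          using \<open>c \<noteq> 0\<close> by (simp add: algebra_simps)
        finally have "U (inverse c * d) = Q"
          unfolding U_def using A Q btA by (intro span_insert_eq_subspace) auto
        then show ?thesis using V'eq F_def by auto
      qed
    qed
  qed
  have trans: "\<exists>g\<in>GL. flag_act {0..CARD('n)} W g = W \<and> flag_act {0..CARD('n)} (F s) g = F t" for s t
  proof -
    \<comment> \<open>A map \<open>x + (t - s) *s h x\<close> with the values of \<open>h\<close> in
      the line of \<open>a\<close> preserves each subspace that \<open>h\<close> kills or that
      contains \<open>a\<close>. If \<open>h\<close> vanishes on \<open>D\<close>, every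
      \<open>W l\<close> and every \<open>V l\<close> except \<open>V (Suc i)\<close> is of one of
      these kinds, and \<open>h b = a\<close> moves \<open>b + s *s a\<close> to
      \<open>b + t *s a\<close>.\<close>
    define D where "D = vec.span (W m' \<union> A)"
    have bD: "b \<notin> D"
    proof
      assume "b \<in> D"
      then obtain w v where wv: "b = w + v" "w \<in> W m'" "v \<in> A"
        unfolding D_def vec.span_Un using A Wsub mm by (auto simp: vec.span_eq_iff[THEN iffD2])
      have "b - v \<in> C" using b wv AC C by (intro vec.subspace_diff) auto
      then have "w \<in> L" using wv Wm' L_def by auto
      then have "b \<in> L" using wv L by (auto intro: vec.subspace_add)
      then show False using b L_def by simp
    qed
    obtain h where h: "Vector_Spaces.linear (*s) (*s) h" "\<And>x. x \<in> D \<Longrightarrow> h x = 0" "h b = a"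
      "\<And>x. \<exists>c. h x = c *s a"
      using shear_exists[OF vec.subspace_span[of "W m' \<union> A"], folded D_def, OF bD] by blast
    interpret h: Vector_Spaces.linear "(*s)" "(*s)" h by fact
    have WD: "W m' \<subseteq> D" "A \<subseteq> D" unfolding D_def using vec.span_superset by blast+
    have "a \<in> W m'" using a mm Wmono by auto
    then have ha: "h a = 0" using h WD by auto
    have hh: "h (h x) = 0" for x using h(4)[of x] ha by (auto simp: h.scale)
    obtain g where g: "g \<in> GL" "\<And>x. x v* g = x + (t - s) *s h x"
      using shear_matrix[OF h(1) hh] by blast
    have stab: "(\<lambda>x. x v* g) ` S = S" if "vec.subspace S" "S \<subseteq> D \<or> a \<in> S" for S
    proof -
      have "h x \<in> S" if "x \<in> S" for x
      proof (cases "S \<subseteq> D")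
        case True
        then show ?thesis using h(2) that \<open>vec.subspace S\<close> by (auto simp: subset_iff vec.subspace_0)
      next
        case False
        then have "a \<in> S" using \<open>S \<subseteq> D \<or> a \<in> S\<close> by auto
        then show ?thesis using h(4)[of x] \<open>vec.subspace S\<close> by (auto simp: vec.subspace_scale)
      qed
      then show ?thesis
        unfolding g(2) using that by (intro shear_image_subspace h hh) auto
    qed
    have "(\<lambda>x. x v* g) ` W l = W l" if "l \<le> CARD('n)" for l
    proof (rule stab)
      show "W l \<subseteq> D \<or> a \<in> W l"
        using WD complete_flags_mono[OF W, of l m'] Wmono[OF \<open>a \<in> W m'\<close>, of l] mm that
        by (cases "l \<le> m'") auto
    qed (use Wsub that in auto)
    then have gW: "flag_act {0..CARD('n)} W g = W"
      using complete_flags_ext[OF W] by (auto simp: flag_act_def fun_eq_iff extensional_def)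
    have gV: "(\<lambda>x. x v* g) ` V l = V l" if "l \<le> CARD('n)" "l \<noteq> Suc i" for l
    proof (rule stab)
      show "V l \<subseteq> D \<or> a \<in> V l"
      proof (cases "l \<le> i")
        case True
        then show ?thesis using complete_flags_mono[OF V, of l i] WD A_def i by auto
      next
        case False
        then show ?thesis
          using complete_flags_mono[OF V, of "Suc (Suc i)" l] a C_def that by auto
      qed
    qed (use V that complete_flags_subspace in auto)
    have "(\<lambda>x. x v* g) ` U s = U t"
    proof (rule vec.subspace_dim_equal)
      show "(\<lambda>x. x v* g) ` U s \<subseteq> U t"
      proof
        fix y assume "y \<in> (\<lambda>x. x v* g) ` U s"
        then obtain x c where x: "y = x + (t - s) *s h x" "x - c *s (b + s *s a) \<in> A"
          unfolding g(2) U_def image_iff Bex_def spA by blast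
        have "h (x - c *s (b + s *s a)) = 0" using h(2) WD x by blast
        then have "h x = c *s a" by (simp add: h.add h.scale h.diff ha h(3))
        then have "y - c *s (b + t *s a) = x - c *s (b + s *s a)"
          by (simp add: x vec.scale_left_diff_distrib vec.scale_right_distrib mult.commute algebra_simps)
        then show "y \<in> U t" unfolding U_def spA using x by metis
      qed
      have "vec.dim ((\<lambda>x. x v* g) ` U s) = vec.dim (U s)"
        by (rule vec.dim_image_eq[OF linear_vector_matrix_mult])
           (rule inj_on_subset[OF vector_matrix_mult_inj[OF g(1)]], simp)
      then show "vec.dim (U t) \<le> vec.dim ((\<lambda>x. x v* g) ` U s)"
        using U by simp
    qed (rule vec.linear_subspace_image[OF linear_vector_matrix_mult U(1)] U(1))+
    then have "flag_act {0..CARD('n)} (F s) g = F t"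
      using complete_flags_ext[OF V] gV i
      by (auto simp: flag_act_def fun_eq_iff F_def extensional_def)
    then show ?thesis using gW g by blast
  qed
  have count: "flag_k (F t) W = Suc (flag_k V0 W)" for t
  proof -
    define row where "row V' k = card {l. l < CARD('n) \<and> V' (Suc k) \<inter> W (Suc l) \<subseteq> V' k \<inter> W l}"
      for V' :: "nat \<Rightarrow> ('a ^ 'n) set" and k
    define rest where "rest = (\<Sum>k\<in>{..<CARD('n)} - {i, Suc i}. row V k)"
    have split: "flag_k (V(Suc i := Q)) W = rest + row (V(Suc i := Q)) i + row (V(Suc i := Q)) (Suc i)"
      if "V(Suc i := Q) \<in> complete_flags" for Q
    proof -
      have "flag_k (V(Suc i := Q)) W = (\<Sum>k<CARD('n). row (V(Suc i := Q)) k)"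
        unfolding row_def by (rule flag_k_eq_sum[OF that W])
      also have "{..<CARD('n)} = insert i (insert (Suc i) ({..<CARD('n)} - {i, Suc i}))"
        using i by auto
      also have "(\<Sum>k\<in>\<dots>. row (V(Suc i := Q)) k) = row (V(Suc i := Q)) i + (row (V(Suc i := Q)) (Suc i)
          + (\<Sum>k\<in>{..<CARD('n)} - {i, Suc i}. row (V(Suc i := Q)) k))"
        by (subst sum.insert; simp)+
      also have "(\<Sum>k\<in>{..<CARD('n)} - {i, Suc i}. row (V(Suc i := Q)) k) = rest"
        unfolding rest_def row_def by (intro sum.cong) auto
      finally show ?thesis by (simp only: add_ac)
    qed
    \<comment> \<open>\<open>E\<close> collects the steps of \<open>W\<close> at which the trace on
      \<open>A\<close> does not grow. Replacing \<open>L\<close> by \<open>U t\<close> interchanges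
      the two affected rows except for the index \<open>m\<close>, which accounts for the single
      extra pair.\<close>
    define E where "E = {l. l < CARD('n) \<and> A \<inter> W (Suc l) \<subseteq> W l}"
    have finE: "finite E" unfolding E_def by simp
    have rowL1: "l < CARD('n) \<Longrightarrow> L \<inter> W (Suc l) \<subseteq> A \<inter> W l \<longleftrightarrow> l \<in> E \<and> l < m" for l
    proof -
      assume l: "l < CARD('n)"
      show ?thesis
      proof (cases "l < m")
        case True
        then have "L \<inter> W (Suc l) \<subseteq> A" using Wm Wmono[of _ "Suc l" m] mm L by auto
        then show ?thesis using True l L by (auto simp: E_def)
      next
        case False
        then show ?thesis using a L Wmono[of a "Suc m" "Suc l"] l by auto
      qed
    qed
    have rowL2: "l < CARD('n) \<Longrightarrow> C \<inter> W (Suc l) \<subseteq> L \<inter> W l \<longleftrightarrow> l \<in> E \<and> l < m' \<and> l \<noteq> m" for l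
    proof -
      assume l: "l < CARD('n)"
      consider "m' \<le> l" | "l = m" | "l < m" | "m < l" "l < m'" by linarith
      then show ?thesis
      proof cases
        case 1
        then show ?thesis using b L_def Wmono[of b "Suc m'" "Suc l"] l by auto
      next
        case 2
        then show ?thesis using a Wm by auto
      next
        case 3
        then have "C \<inter> W (Suc l) \<subseteq> A" using Wm Wmono[of _ "Suc l" m] mm by auto
        then show ?thesis using 3 l L AC mm by (auto simp: E_def)
      next
        case 4
        have CL: "C \<inter> W (Suc l) \<subseteq> L" using Wm' Wmono[of _ "Suc l" m'] mm 4 L_def by auto
        have al: "a \<in> W l" using a Wmono[of a "Suc m" l] 4 l by auto
        have "C \<inter> W (Suc l) \<subseteq> W l" if "A \<inter> W (Suc l) \<subseteq> W l"
        proof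
          fix x assume x: "x \<in> C \<inter> W (Suc l)"
          then have "x \<in> L" using CL by auto
          then obtain c where c: "x - c *s a \<in> A" unfolding L_def spA by auto
          moreover have "x - c *s a \<in> W (Suc l)"
            using x al l complete_flags_mono[OF W, of l "Suc l"]
            by (intro vec.subspace_diff vec.subspace_scale Wsub) auto
          ultimately have "x - c *s a \<in> W l" using that by auto
          then have "x - c *s a + c *s a \<in> W l"
            using al l by (intro vec.subspace_add vec.subspace_scale Wsub) auto
          then show "x \<in> W l" by simp
        qed
        then show ?thesis using 4 CL AC l by (auto simp: E_def)
      qed
    qed
    have rowU1: "l < CARD('n) \<Longrightarrow> U t \<inter> W (Suc l) \<subseteq> A \<inter> W l \<longleftrightarrow> l \<in> E \<and> l < m'" for l
    proof -
      assume l: "l < CARD('n)"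
      show ?thesis
      proof (cases "l < m'")
        case True
        then have "W (Suc l) \<subseteq> W m'" using mm by (intro complete_flags_mono[OF W]) auto
        then have "U t \<inter> W (Suc l) \<subseteq> A"
          using Wm' U(3)[of t] UL[of t] unfolding L_def by blast
        then show ?thesis using True l U(4)[of t] by (auto simp: E_def)
      next
        case False
        then show ?thesis using bt[of t] btA[of t] U(5)[of t] Wmono[of "b + t *s a" "Suc m'" "Suc l"] l by auto
      qed
    qed
    have rowU2: "l < CARD('n) \<Longrightarrow> C \<inter> W (Suc l) \<subseteq> U t \<inter> W l \<longleftrightarrow> l \<in> E \<and> l < m" for l
    proof -
      assume l: "l < CARD('n)"
      show ?thesis
      proof (cases "l < m")
        case True
        then have "C \<inter> W (Suc l) \<subseteq> A" using Wm Wmono[of _ "Suc l" m] mm by auto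
        then show ?thesis using True l U(4)[of t] AC by (auto simp: E_def)
      next
        case False
        have "a \<notin> U t" using UL L a by blast
        then show ?thesis using a False Wmono[of a "Suc m" "Suc l"] l by auto
      qed
    qed
    have eqs: "V0 i = A" "V0 (Suc i) = L" "V0 (Suc (Suc i)) = C"
      "F t i = A" "F t (Suc i) = U t" "F t (Suc (Suc i)) = C"
      by (simp_all add: V0_def F_def A_def C_def)
    have E: "{l. l < CARD('n) \<and> P l} = {l \<in> E. P' l}"
      if "\<And>l. l < CARD('n) \<Longrightarrow> P l \<longleftrightarrow> l \<in> E \<and> P' l" for P P'
      using that unfolding E_def by blast
    have rows: "row V0 i = card {l \<in> E. l < m}" "row V0 (Suc i) = card {l \<in> E. l < m' \<and> l \<noteq> m}"
       "row (F t) i = card {l \<in> E. l < m'}" "row (F t) (Suc i) = card {l \<in> E. l < m}"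
      unfolding row_def eqs
      by (rule arg_cong[where f = card], rule E, erule rowL1 rowL2 rowU1 rowU2)+
    \<comment> \<open>If the trace on \<open>A\<close> grew at step \<open>m\<close>, subtracting a
      multiple of a new vector \<open>x\<close> of \<open>A\<close> from \<open>a\<close> would land
      in \<open>C \<inter> W m\<close>, hence in \<open>A\<close>, and put \<open>a\<close> itself
      into \<open>A\<close>.\<close>
    have "m \<in> E"
    proof -
      have "A \<inter> W (Suc m) \<subseteq> W m"
      proof (rule ccontr)
        assume "\<not> A \<inter> W (Suc m) \<subseteq> W m"
        then obtain x where x: "x \<in> A" "x \<in> W (Suc m)" "x \<notin> W m" by auto
        have "vec.span (insert x (W m)) = W (Suc m)"
          using x mm W complete_flags_mono[OF W, of m "Suc m"]
          by (intro span_insert_eq_subspace) (auto simp: complete_flags_subspace complete_flags_dim)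
        then obtain c where c: "a - c *s x \<in> W m"
          using span_insert_subspace_iff[OF Wsub, of m a x] a mm by auto
        moreover have "a - c *s x \<in> C"
          using a x AC C by (intro vec.subspace_diff vec.subspace_scale) auto
        ultimately have "a - c *s x \<in> A" using Wm by auto
        then have "a - c *s x + c *s x \<in> A" using x A by (intro vec.subspace_add vec.subspace_scale)
        then show False using a by simp
      qed
      then show ?thesis using mm by (auto simp: E_def)
    qed
    then have "{l \<in> E. l < m'} = insert m {l \<in> E. l < m' \<and> l \<noteq> m}" using mm by auto
    then have "card {l \<in> E. l < m'} = Suc (card {l \<in> E. l < m' \<and> l \<noteq> m})" using finE by simp
    then show ?thesis
      using split FX V0X rows unfolding F_def V0_def by simp
  qed
  \<comment> \<open>\<open>L\<close> leaves \<open>A\<close> already at \<open>Suc m\<close>, while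
    \<open>C\<close> leaves \<open>L\<close> only at indices above \<open>m'\<close>, which is at
    least \<open>Suc m\<close>.\<close>
  have desc: "\<exists>l'<l. \<not> V0 (Suc i) \<inter> W l' \<subseteq> V0 i"
    if l: "l \<le> CARD('n)" "\<not> V0 (Suc (Suc i)) \<inter> W l \<subseteq> V0 (Suc i)" for l
  proof (intro exI conjI)
    have eqs: "V0 i = A" "V0 (Suc i) = L" "V0 (Suc (Suc i)) = C" by (auto simp: V0_def A_def C_def)
    show "\<not> V0 (Suc i) \<inter> W (Suc m) \<subseteq> V0 i" unfolding eqs using a L by auto
    have "m' < l"
    proof (rule ccontr)
      assume "\<not> m' < l"
      then have "W l \<subseteq> W m'" using mm complete_flags_mono[OF W] by auto
      then show False using l Wm' unfolding eqs L_def by auto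
    qed
    then show "Suc m < l" using mm by auto
  qed
  show thesis
  proof
    show "panel (Suc i) V = insert V0 (range F)" by (rule panelF)
    show "V0 \<notin> range F" using V0F by auto
    show "card (range F) = CARD('a)" using injF by (simp add: card_image)
    show "flag_k V' W = Suc (flag_k V0 W)" if "V' \<in> range F" for V' using that count by auto
    show "\<exists>g\<in>GL. flag_act {0..CARD('n)} W g = W \<and> flag_act {0..CARD('n)} V' g = V''"
      if "V' \<in> range F" "V'' \<in> range F" for V' V'' using that trans by auto
  qed (use desc in auto)
qed

subsection \<open>Functions with vanishing panel sums\<close>

lemma panel_self: "V \<in> complete_flags \<Longrightarrow> V \<in> panel j V"
  by (simp add: panel_def)

text \<open>The jump of \<open>W\<close> in \<open>V (Suc i) / V i\<close> comes no earlier than the one in the next quotient; if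
  all jumps were increasing, the relative position of \<open>V\<close> and \<open>W\<close> would be the identity.\<close>

lemma panel_descent:
  fixes V W :: "nat \<Rightarrow> ('a::field ^ 'n) set"
  assumes V: "V \<in> complete_flags" and W: "W \<in> complete_flags" and "V \<noteq> W"
  obtains i l where "Suc i < CARD('n)" "l \<le> CARD('n)" "\<not> V (Suc (Suc i)) \<inter> W l \<subseteq> V (Suc i)"
    "\<And>l'. l' < l \<Longrightarrow> V (Suc i) \<inter> W l' \<subseteq> V i"
proof -
  have False if desc: "\<And>i l. \<lbrakk>Suc i < CARD('n); l \<le> CARD('n); \<not> V (Suc (Suc i)) \<inter> W l \<subseteq> V (Suc i)\<rbrakk>
      \<Longrightarrow> \<exists>l'<l. \<not> V (Suc i) \<inter> W l' \<subseteq> V i"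
  proof -
    \<comment> \<open>Downward from the top: the last jump is at most \<open>n\<close>, and each
      strict decrease lowers the bound by one, so the jump in \<open>V (Suc k) / V k\<close> is at
      most \<open>Suc k\<close>.\<close>
    have *: "\<exists>l\<le>Suc k. \<not> V (Suc k) \<inter> W l \<subseteq> V k" if "k \<le> CARD('n) - 1" for k
      using that
    proof (induction k rule: inc_induct)
      case base
      then show ?case
        using complete_flags_top[OF V] complete_flags_top[OF W] complete_flags_strict[OF V, of "CARD('n) - 1" "CARD('n)"]
        by (intro exI[of _ "CARD('n)"]) auto
    next
      case (step k)
      then obtain l where l: "l \<le> Suc (Suc k)" "\<not> V (Suc (Suc k)) \<inter> W l \<subseteq> V (Suc k)" by blast
      have "Suc k < CARD('n)" using step.hyps by arith
      with l obtain l' where "l' < l" "\<not> V (Suc k) \<inter> W l' \<subseteq> V k"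
        using desc[of k l] by (meson Suc_leI order_trans)
      then show ?case using l(1) by (intro exI[of _ l']) auto
    qed
    \<comment> \<open>Upward: a vector of \<open>W (Suc k)\<close> that is new in
      \<open>V (Suc k)\<close> generates both subspaces over the common
      \<open>V k = W k\<close>.\<close>
    have "V k = W k" if "k \<le> CARD('n)" for k
      using that
    proof (induction k)
      case 0
      then show ?case using complete_flags_0 V W by metis
    next
      case (Suc k)
      have "k \<le> CARD('n) - 1" using Suc.prems by arith
      from *[OF this] obtain l x where "l \<le> Suc k" "x \<in> V (Suc k)" "x \<in> W l" "x \<notin> V k"
        by blast
      then have x: "x \<in> V (Suc k)" "x \<in> W (Suc k)" "x \<notin> V k"
        using complete_flags_mono[OF W, of l "Suc k"] Suc by auto
      have "vec.span (insert x (U k)) = U (Suc k)"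
        if "U \<in> complete_flags" "x \<in> U (Suc k)" "x \<notin> U k" for U :: "nat \<Rightarrow> ('a ^ 'n) set"
        using that complete_flags_mono[OF that(1), of k "Suc k"] Suc.prems
        by (intro span_insert_eq_subspace) (auto simp: complete_flags_subspace complete_flags_dim)
      from this[OF V] this[OF W] show ?case using x Suc by simp
    qed
    then have "V = W"
      using complete_flags_ext[OF V] complete_flags_ext[OF W]
      by (metis atLeastAtMost_iff bot_nat_0.extremum extensionalityI)
    then show False using assms by simp
  qed
  then show thesis using that by blast
qed

text \<open>A descent shows that \<open>V\<close> is not the nearest flag of its panel, so
  \<open>flag_k V W\<close> is the successor of the value at the nearest one.\<close>

lemma flag_k_pos:
  fixes V W :: "nat \<Rightarrow> ('a::{field,finite} ^ 'n) set"
  assumes V: "V \<in> complete_flags" and W: "W \<in> complete_flags" and "V \<noteq> W"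
  shows "flag_k V W > 0"
proof -
  obtain i l where il: "Suc i < CARD('n)" "l \<le> CARD('n)" "\<not> V (Suc (Suc i)) \<inter> W l \<subseteq> V (Suc i)"
    "\<And>l'. l' < l \<Longrightarrow> V (Suc i) \<inter> W l' \<subseteq> V i"
    using panel_descent[OF assms] by blast
  obtain V0 R where R: "panel (Suc i) V = insert V0 R"
    "\<And>V'. V' \<in> R \<Longrightarrow> flag_k V' W = Suc (flag_k V0 W)"
    "\<And>l. l \<le> CARD('n) \<Longrightarrow> \<not> V0 (Suc (Suc i)) \<inter> W l \<subseteq> V0 (Suc i) \<Longrightarrow>
       \<exists>l'<l. \<not> V0 (Suc i) \<inter> W l' \<subseteq> V0 i"
    using panel_structure[OF V W il(1)] by metis
  have "V \<noteq> V0" using R(3)[OF il(2)] il by blast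
  then have "V \<in> R" using R(1) panel_self[OF V, of "Suc i"] by auto
  then show ?thesis using R(2) by simp
qed

section \<open>Values and size of the kernel\<close>

lemma flag_kernel_eq:
  "flag_kernel V W = inverse ((- of_nat CARD('a)) ^ flag_k V W)"
  for V W :: "nat \<Rightarrow> ('a::{field,finite} ^ 'n) set"
  by (simp add: flag_kernel_def power_int_minus)

lemma flag_kernel_commute: "flag_kernel V W = flag_kernel W V"
  by (simp add: flag_kernel_def flag_k_commute)

lemma flag_kernel_self: "V \<in> complete_flags \<Longrightarrow> flag_kernel V V = 1"
  by (simp add: flag_kernel_def flag_k_self)

lemma flag_kernel_nonzero: "flag_kernel V W \<noteq> 0"
  by (simp add: flag_kernel_eq)

lemma flag_kernel_Suc:
  fixes V V' W :: "nat \<Rightarrow> ('a::{field,finite} ^ 'n) set"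
  assumes "flag_k V' W = Suc (flag_k V W)"
  shows "of_nat CARD('a) * flag_kernel V' W = - flag_kernel V W"
  using assms by (simp add: flag_kernel_eq field_simps)

lemma card_field_ge_2: "CARD('a::{field,finite}) \<ge> 2"
proof -
  have "card {0::'a, 1} \<le> CARD('a)" by (intro card_mono) auto
  then show ?thesis by simp
qed

text \<open>Strictness off the diagonal is what later separates two flags of one panel when
  embeddings into functions on incomplete flags are excluded.\<close>

lemma norm_flag_kernel_less:
  fixes V W :: "nat \<Rightarrow> ('a::{field,finite} ^ 'n) set"
  assumes "V \<in> complete_flags" "W \<in> complete_flags" "V \<noteq> W"
  shows "norm (flag_kernel V W) < 1"
proof -
  have "1 < real CARD('a) ^ flag_k V W"
    using flag_k_pos[OF assms] card_field_ge_2[where 'a = 'a] by (intro one_less_power) auto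
  then show ?thesis
    by (simp add: flag_kernel_eq norm_inverse norm_power inverse_less_1_iff)
qed

text \<open>The condition that cuts out \<open>N\<close>, phrased through values at complete flags
  alone, so that it also applies to functions that are not extended by zero.\<close>

definition panel_harmonic :: "((nat \<Rightarrow> ('a::field ^ 'n) set) \<Rightarrow> complex) \<Rightarrow> bool" where
  "panel_harmonic f \<longleftrightarrow> (\<forall>j\<in>{1..CARD('n) - 1}. \<forall>V\<in>complete_flags. (\<Sum>V'\<in>panel j V. f V') = 0)"

lemma finite_panel: "finite (panel j V :: (nat \<Rightarrow> ('a::{field,finite} ^ 'n) set) set)"
  by (rule finite_subset[OF _ finite_complete_flags]) (auto simp: panel_def)

text \<open>Each of the \<open>q\<close> far flags of a panel contributes \<open>- 1 / q\<close>
  times the value at the nearest one.\<close>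

lemma panel_harmonic_kernel:
  fixes W :: "nat \<Rightarrow> ('a::{field,finite} ^ 'n) set"
  assumes W: "W \<in> complete_flags"
  shows "panel_harmonic (\<lambda>V. flag_kernel V W)"
  unfolding panel_harmonic_def
proof (intro ballI)
  fix j and V :: "nat \<Rightarrow> ('a ^ 'n) set"
  assume j: "j \<in> {1..CARD('n) - 1}" and V: "V \<in> complete_flags"
  then obtain i where i: "j = Suc i" "Suc i < CARD('n)" by (cases j) auto
  obtain V0 R where R: "panel (Suc i) V = insert V0 R" "V0 \<notin> R" "card R = CARD('a)"
    "\<And>V'. V' \<in> R \<Longrightarrow> flag_k V' W = Suc (flag_k V0 W)"
    using panel_structure[OF V W i(2)] by metis
  have "finite R" using finite_panel[of "Suc i" V] R by simp
  have "of_nat CARD('a) * (\<Sum>V'\<in>R. flag_kernel V' W) = (\<Sum>V'\<in>R. - flag_kernel V0 W)"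
    unfolding sum_distrib_left using flag_kernel_Suc R(4) by (intro sum.cong refl) blast
  then have "of_nat CARD('a) * (\<Sum>V'\<in>R. flag_kernel V' W) = of_nat CARD('a) * - flag_kernel V0 W"
    using R(3) by simp
  then have "(\<Sum>V'\<in>R. flag_kernel V' W) = - flag_kernel V0 W"
    by (subst (asm) mult_left_cancel) simp_all
  then show "(\<Sum>V'\<in>panel j V. flag_kernel V' W) = 0"
    using R \<open>finite R\<close> i by simp
qed

text \<open>Induction on \<open>flag_k V W\<close>. A flag other than \<open>W\<close> has a
  descent, hence is one of the \<open>q\<close> far flags of a panel. Invariance makes
  \<open>f\<close> constant on these, and the vanishing panel sum expresses \<open>f V\<close>
  through the nearer \<open>V0\<close> by the same factor \<open>- 1 / q\<close> that governs the
  kernel.\<close>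

lemma panel_harmonic_stabilizer_invariant:
  fixes V W :: "nat \<Rightarrow> ('a::{field,finite} ^ 'n) set"
  assumes f: "panel_harmonic f" and W: "W \<in> complete_flags" and V: "V \<in> complete_flags"
    and inv: "\<And>g V. g \<in> GL \<Longrightarrow> flag_act {0..CARD('n)} W g = W \<Longrightarrow> V \<in> complete_flags \<Longrightarrow>
      f (flag_act {0..CARD('n)} V g) = f V"
  shows "f V = f W * flag_kernel V W"
  using V
proof (induction "flag_k V W" arbitrary: V rule: less_induct)
  case less
  show ?case
  proof (cases "V = W")
    case True
    then show ?thesis using flag_kernel_self[OF W] by simp
  next
    case False
    obtain i l where il: "Suc i < CARD('n)" "l \<le> CARD('n)" "\<not> V (Suc (Suc i)) \<inter> W l \<subseteq> V (Suc i)"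
      "\<And>l'. l' < l \<Longrightarrow> V (Suc i) \<inter> W l' \<subseteq> V i"
      using panel_descent[OF less(2) W False] by blast
    obtain V0 R where R: "panel (Suc i) V = insert V0 R" "V0 \<notin> R" "card R = CARD('a)"
      "\<And>V'. V' \<in> R \<Longrightarrow> flag_k V' W = Suc (flag_k V0 W)"
      "\<And>V' V''. V' \<in> R \<Longrightarrow> V'' \<in> R \<Longrightarrow>
         \<exists>g\<in>GL. flag_act {0..CARD('n)} W g = W \<and> flag_act {0..CARD('n)} V' g = V''"
      "\<And>l. l \<le> CARD('n) \<Longrightarrow> \<not> V0 (Suc (Suc i)) \<inter> W l \<subseteq> V0 (Suc i) \<Longrightarrow>
         \<exists>l'<l. \<not> V0 (Suc i) \<inter> W l' \<subseteq> V0 i"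
      using panel_structure[OF less(2) W il(1)] by metis
    have "V \<noteq> V0" using R(6)[OF il(2)] il by blast
    then have VR: "V \<in> R" using R(1) panel_self[OF less(2), of "Suc i"] by auto
    have "V0 \<in> panel (Suc i) V" using R(1) by simp
    then have V0: "V0 \<in> complete_flags" by (simp add: panel_def)
    have "finite R" using finite_panel[of "Suc i" V] R by simp
    have "f V' = f V" if "V' \<in> R" for V'
      using R(5)[OF VR that] inv less(2) by blast
    then have "(\<Sum>V'\<in>R. f V') = of_nat CARD('a) * f V" using R(3) by simp
    moreover have "(\<Sum>V'\<in>panel (Suc i) V. f V') = 0"
      using f il less(2) unfolding panel_harmonic_def by auto
    ultimately have "f V0 + of_nat CARD('a) * f V = 0"
      using R \<open>finite R\<close> by simp
    moreover have "f V0 = f W * flag_kernel V0 W"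
      using R(4)[OF VR] V0 by (intro less(1)) auto
    moreover have "of_nat CARD('a) * flag_kernel V W = - flag_kernel V0 W"
      using flag_kernel_Suc R(4)[OF VR] by blast
    ultimately have "of_nat CARD('a) * f V = of_nat CARD('a) * (f W * flag_kernel V W)"
      by (metis add.inverse_inverse add_eq_0_iff mult.left_commute mult_minus_right)
    then show ?thesis by simp
  qed
qed

section \<open>Existence and completion of flags\<close>

lemma panel_nontrivial:
  fixes V :: "nat \<Rightarrow> ('a::{field,finite} ^ 'n) set"
  assumes V: "V \<in> complete_flags" and i: "Suc i < CARD('n)"
  obtains W where "W \<in> panel (Suc i) V" "W \<noteq> V"
proof -
  obtain V0 R where R: "panel (Suc i) V = insert V0 R" "V0 \<notin> R" "card R = CARD('a)"
    using panel_structure[OF V V i] by metis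
  then have "card R \<noteq> 0" by simp
  then obtain V1 where "V1 \<in> R" by fastforce
  then show thesis using that[of V0] that[of V1] R by (metis insert_iff)
qed

text \<open>Allows one to conclude that a function on \<open>Fl_j(n)\<close> is zero from its values
  at restrictions of complete flags.\<close>

lemma flags_restrict_surj:
  fixes V' :: "nat \<Rightarrow> ('a::field ^ 'n) set"
  assumes V': "V' \<in> flags ({0..CARD('n)} - {Suc i})" and i: "Suc i < CARD('n)"
  obtains V where "V \<in> complete_flags" "restrict V ({0..CARD('n)} - {Suc i}) = V'"
proof -
  have s: "vec.subspace (V' i)" "vec.subspace (V' (Suc (Suc i)))" "V' i \<subseteq> V' (Suc (Suc i))"
    "vec.dim (V' i) = i" "vec.dim (V' (Suc (Suc i))) = Suc (Suc i)"
    using V' i by (auto simp: flags_def)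
  then have "\<not> V' (Suc (Suc i)) \<subseteq> V' i" using vec.dim_subset[of "V' (Suc (Suc i))" "V' i"] by auto
  then obtain a where a: "a \<in> V' (Suc (Suc i))" "a \<notin> V' i" by auto
  define U where "U = vec.span (insert a (V' i))"
  have "V'(Suc i := U) \<in> complete_flags"
    unfolding U_def
  proof (rule flag_update[OF V' i])
    show "V' i \<subseteq> vec.span (insert a (V' i))" using vec.span_superset by blast
    show "vec.span (insert a (V' i)) \<subseteq> V' (Suc (Suc i))"
      using s a by (intro vec.span_minimal) auto
  qed (use dim_span_insert_subspace[OF s(1) a(2)] s in auto)
  moreover have "restrict (V'(Suc i := U)) ({0..CARD('n)} - {Suc i}) = V'"
    using V' by (auto simp: flags_def fun_eq_iff extensional_def)
  ultimately show thesis using that by blast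
qed

lemma complete_flags_nonempty: "(complete_flags :: (nat \<Rightarrow> ('a::field ^ 'n) set) set) \<noteq> {}"
proof -
  have "\<exists>V :: nat \<Rightarrow> ('a ^ 'n) set. (\<forall>i\<le>k. vec.subspace (V i) \<and> vec.dim (V i) = i) \<and>
      (\<forall>i j. i \<le> j \<longrightarrow> j \<le> k \<longrightarrow> V i \<subseteq> V j)" if "k \<le> CARD('n)" for k
    using that
  proof (induction k)
    case 0
    then show ?case by (intro exI[of _ "\<lambda>_. {0}"]) auto
  next
    case (Suc k)
    then obtain V :: "nat \<Rightarrow> ('a ^ 'n) set" where V: "\<forall>i\<le>k. vec.subspace (V i) \<and> vec.dim (V i) = i"
      "\<forall>i j. i \<le> j \<longrightarrow> j \<le> k \<longrightarrow> V i \<subseteq> V j" by auto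
    have "V k \<noteq> UNIV"
    proof
      assume "V k = UNIV"
      then have "vec.dim (UNIV :: ('a ^ 'n) set) = k" using V(1) by (metis order_refl)
      then show False using Suc by (simp add: vec_dim_card del: vec.dim_UNIV)
    qed
    then obtain a where a: "a \<notin> V k" by auto
    define U where "U = vec.span (insert a (V k))"
    have U: "vec.subspace U" "vec.dim U = Suc k" "V k \<subseteq> U"
      using V a dim_span_insert_subspace[of "V k" a] vec.span_superset[of "insert a (V k)"]
      by (auto simp: U_def)
    have "V i \<subseteq> U" if "i \<le> k" for i using V(2) U(3) that by blast
    then show ?case
      using V U by (intro exI[of _ "V(Suc k := U)"]) (auto simp: le_Suc_eq)
  qed
  then obtain V :: "nat \<Rightarrow> ('a ^ 'n) set" where
    "\<forall>i\<le>CARD('n). vec.subspace (V i) \<and> vec.dim (V i) = i"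
    "\<forall>i j. i \<le> j \<longrightarrow> j \<le> CARD('n) \<longrightarrow> V i \<subseteq> V j" by blast
  then have "restrict V {0..CARD('n)} \<in> complete_flags"
    by (auto simp: complete_flags_def flags_def)
  then show ?thesis by blast
qed

subsection \<open>Intertwining maps\<close>

lemma GL_one: "mat 1 \<in> (GL :: ('a::field ^ 'n ^ 'n) set)"
  by (auto simp: GL_def invertible_def intro!: exI[of _ "mat 1"])

lemma GL_mult: "g \<in> GL \<Longrightarrow> h \<in> GL \<Longrightarrow> g ** h \<in> GL"
  by (simp add: GL_def invertible_mult)

lemma
  fixes g :: "'a::field ^ 'n ^ 'n"
  assumes "g \<in> GL"
  shows GL_right_inverse: "g ** matrix_inv g = mat 1"
    and GL_left_inverse: "matrix_inv g ** g = mat 1"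
    and GL_inverse: "matrix_inv g \<in> GL"
    and GL_inverse_inverse: "matrix_inv (matrix_inv g) = g"
proof -
  have inv: "h ** matrix_inv h = mat 1 \<and> matrix_inv h ** h = mat 1" if "h \<in> GL" for h :: "'a ^ 'n ^ 'n"
    using that unfolding GL_def invertible_def matrix_inv_def mem_Collect_eq by (rule someI_ex)
  show 1: "g ** matrix_inv g = mat 1" "matrix_inv g ** g = mat 1"
    using inv[OF assms] by auto
  show 2: "matrix_inv g \<in> GL" using 1 by (auto simp: GL_def invertible_def)
  have "matrix_inv g ** matrix_inv (matrix_inv g) = mat 1" using inv[OF 2] by blast
  then have "g ** (matrix_inv g ** matrix_inv (matrix_inv g)) = g" by simp
  then show "matrix_inv (matrix_inv g) = g" by (simp add: matrix_mul_assoc 1)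
qed

lemma vector_space_subspace_iff:
  assumes "vector_space s"
  shows "module.subspace s U \<longleftrightarrow>
    0 \<in> U \<and> (\<forall>x\<in>U. \<forall>y\<in>U. x + y \<in> U) \<and> (\<forall>c. \<forall>x\<in>U. s c x \<in> U)"
proof -
  interpret vector_space s by fact
  show ?thesis by (rule subspace_def)
qed

lemma
  assumes "representation R"
  shows representation_vector_space: "vector_space (scale_of R)"
    and representation_zero: "0 \<in> space_of R"
    and representation_add: "x \<in> space_of R \<Longrightarrow> y \<in> space_of R \<Longrightarrow> x + y \<in> space_of R"
    and representation_diff: "x \<in> space_of R \<Longrightarrow> y \<in> space_of R \<Longrightarrow> x - y \<in> space_of R"
    and representation_scale: "x \<in> space_of R \<Longrightarrow> scale_of R c x \<in> space_of R"
    and representation_act: "g \<in> GL \<Longrightarrow> x \<in> space_of R \<Longrightarrow> act R g x \<in> space_of R"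
    and representation_act_add: "g \<in> GL \<Longrightarrow> x \<in> space_of R \<Longrightarrow> y \<in> space_of R \<Longrightarrow>
      act R g (x + y) = act R g x + act R g y"
proof -
  show vs: "vector_space (scale_of R)" using assms by (simp add: representation_def)
  have sub: "module.subspace (scale_of R) (space_of R)" using assms by (simp add: representation_def)
  interpret vector_space "scale_of R" by (rule vs)
  show "0 \<in> space_of R" by (rule subspace_0[OF sub])
  show "x \<in> space_of R \<Longrightarrow> y \<in> space_of R \<Longrightarrow> x + y \<in> space_of R" by (rule subspace_add[OF sub])
  show "x \<in> space_of R \<Longrightarrow> y \<in> space_of R \<Longrightarrow> x - y \<in> space_of R" by (rule subspace_diff[OF sub])
  show "x \<in> space_of R \<Longrightarrow> scale_of R c x \<in> space_of R" by (rule subspace_scale[OF sub])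
qed (use assms in \<open>auto simp: representation_def clinear_between_def\<close>)

text \<open>The map of \<open>rep_equiv\<close> stripped of bijectivity, so that panel sums and
  evaluation maps fall under it too.\<close>

definition intertwiner ::
  "('a::field ^ 'n ^ 'n, 'v::ab_group_add) crep \<Rightarrow> ('a ^ 'n ^ 'n, 'w::ab_group_add) crep \<Rightarrow>
   ('v \<Rightarrow> 'w) \<Rightarrow> bool" where
  "intertwiner R S T \<longleftrightarrow> clinear_between R S T \<and>
     (\<forall>g\<in>GL. \<forall>x\<in>space_of R. T (act R g x) = act S g (T x))"

lemma
  assumes "intertwiner R S T"
  shows intertwiner_mem: "x \<in> space_of R \<Longrightarrow> T x \<in> space_of S"
    and intertwiner_add: "x \<in> space_of R \<Longrightarrow> y \<in> space_of R \<Longrightarrow> T (x + y) = T x + T y"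
    and intertwiner_scale: "x \<in> space_of R \<Longrightarrow> T (scale_of R c x) = scale_of S c (T x)"
    and intertwiner_act: "g \<in> GL \<Longrightarrow> x \<in> space_of R \<Longrightarrow> T (act R g x) = act S g (T x)"
  using assms by (auto simp: intertwiner_def clinear_between_def)

lemma intertwiner_zero:
  assumes "intertwiner R S T" "representation R"
  shows "T 0 = 0"
  using intertwiner_add[OF assms(1), of 0 0] representation_zero[OF assms(2)] by simp

lemma intertwiner_diff:
  assumes "intertwiner R S T" "representation R" "x \<in> space_of R" "y \<in> space_of R"
  shows "T (x - y) = T x - T y"
  using intertwiner_add[OF assms(1), of "x - y" y] representation_diff[OF assms(2-4)] assms(4) by simp

lemma intertwiner_sum:
  assumes "intertwiner R S T" "representation R" "\<And>a. a \<in> A \<Longrightarrow> F a \<in> space_of R"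
  shows "(\<Sum>a\<in>A. F a) \<in> space_of R" "T (\<Sum>a\<in>A. F a) = (\<Sum>a\<in>A. T (F a))"
proof -
  have "(\<Sum>a\<in>A. F a) \<in> space_of R \<and> T (\<Sum>a\<in>A. F a) = (\<Sum>a\<in>A. T (F a))"
    using assms(3)
    by (induction A rule: infinite_finite_induct)
      (auto simp: intertwiner_zero[OF assms(1,2)] representation_zero[OF assms(2)]
        intertwiner_add[OF assms(1)] representation_add[OF assms(2)])
  then show "(\<Sum>a\<in>A. F a) \<in> space_of R" "T (\<Sum>a\<in>A. F a) = (\<Sum>a\<in>A. T (F a))" by auto
qed

lemma intertwiner_comp:
  assumes "intertwiner R S T" "intertwiner S Q T'"
  shows "intertwiner R Q (T' \<circ> T)"
  using assms by (auto simp: intertwiner_def clinear_between_def)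

lemma intertwiner_inv_into:
  assumes T: "intertwiner R S T" and R: "representation R" and bij: "bij_betw T (space_of R) (space_of S)"
  shows "intertwiner S R (inv_into (space_of R) T)"
proof -
  have inv: "inv_into (space_of R) T y \<in> space_of R" "T (inv_into (space_of R) T y) = y"
    if "y \<in> space_of S" for y
    using bij that by (auto simp: bij_betw_def f_inv_into_f inv_into_into)
  have eq: "inv_into (space_of R) T y = x" if "x \<in> space_of R" "T x = y" for x y
    using bij that by (auto simp: bij_betw_def)
  show ?thesis
    unfolding intertwiner_def clinear_between_def
    by (intro conjI ballI allI)
       (auto intro!: eq simp: inv intertwiner_add[OF T] intertwiner_scale[OF T] intertwiner_act[OF T]
        representation_add[OF R] representation_scale[OF R] representation_act[OF R])
qed

lemma rep_equiv_iff:
  "rep_equiv R S \<longleftrightarrow> representation R \<and> representation S \<and>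
     (\<exists>T. intertwiner R S T \<and> bij_betw T (space_of R) (space_of S))"
  unfolding rep_equiv_def intertwiner_def by blast

lemma rep_equiv_sym: "rep_equiv R S \<Longrightarrow> rep_equiv S R"
  unfolding rep_equiv_iff using intertwiner_inv_into bij_betw_inv_into by blast

lemma rep_equiv_trans: "rep_equiv R S \<Longrightarrow> rep_equiv S Q \<Longrightarrow> rep_equiv R Q"
  unfolding rep_equiv_iff using intertwiner_comp bij_betw_trans by blast

section \<open>Invariant subspaces, containment and Schur's lemma\<close>

lemma invariant_subspace_iff:
  assumes "representation R"
  shows "invariant_subspace R U \<longleftrightarrow> U \<subseteq> space_of R \<and> 0 \<in> U \<and> (\<forall>x\<in>U. \<forall>y\<in>U. x + y \<in> U) \<and>
    (\<forall>c. \<forall>x\<in>U. scale_of R c x \<in> U) \<and> (\<forall>g\<in>GL. \<forall>x\<in>U. act R g x \<in> U)"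
  unfolding invariant_subspace_def vector_space_subspace_iff[OF representation_vector_space[OF assms]]
  by blast

lemma invariant_subspace_space: "representation R \<Longrightarrow> invariant_subspace R (space_of R)"
  by (auto simp: invariant_subspace_iff representation_zero representation_add representation_scale
      representation_act)

lemma invariant_subspace_sum:
  assumes "representation R" "invariant_subspace R U" "\<And>a. a \<in> A \<Longrightarrow> F a \<in> U"
  shows "(\<Sum>a\<in>A. F a) \<in> U"
  using assms by (induction A rule: infinite_finite_induct) (auto simp: invariant_subspace_iff)

lemma representation_restrict:
  assumes "representation R" "invariant_subspace R U"
  shows "representation (R\<lparr>space_of := U\<rparr>)"
  using assms unfolding representation_def invariant_subspace_def clinear_between_def
  by (auto simp: subset_iff)

lemma representation_scale_zero:
  assumes "representation R"
  shows "scale_of R c 0 = 0"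
proof -
  interpret vector_space "scale_of R" by (rule representation_vector_space[OF assms])
  show ?thesis by simp
qed

lemma representation_act_zero:
  assumes "representation R" "g \<in> GL"
  shows "act R g 0 = 0"
  using representation_act_add[OF assms, of 0 0] representation_zero[OF assms(1)] by simp

lemma intertwiner_image:
  assumes R: "representation R" and S: "representation S" and T: "intertwiner R S T"
    and U: "invariant_subspace R U"
  shows "invariant_subspace S (T ` U)"
proof -
  have U': "U \<subseteq> space_of R" "0 \<in> U" "\<And>x y. x \<in> U \<Longrightarrow> y \<in> U \<Longrightarrow> x + y \<in> U"
    "\<And>c x. x \<in> U \<Longrightarrow> scale_of R c x \<in> U" "\<And>g x. g \<in> GL \<Longrightarrow> x \<in> U \<Longrightarrow> act R g x \<in> U"
    using U by (auto simp: invariant_subspace_iff[OF R])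
  have "T ` U \<subseteq> space_of S" using U'(1) intertwiner_mem[OF T] by blast
  moreover have "0 \<in> T ` U" using intertwiner_zero[OF T R] U'(2) by (metis imageI)
  moreover have "T x + T y \<in> T ` U" if "x \<in> U" "y \<in> U" for x y
    using intertwiner_add[OF T, of x y] U'(1,3) that by (metis imageI subsetD)
  moreover have "scale_of S c (T x) \<in> T ` U" if "x \<in> U" for x c
    using intertwiner_scale[OF T, of x c] U'(1,4) that by (metis imageI subsetD)
  moreover have "act S g (T x) \<in> T ` U" if "g \<in> GL" "x \<in> U" for x g
    using intertwiner_act[OF T, of g x] U'(1,5) that by (metis imageI subsetD)
  ultimately show ?thesis unfolding invariant_subspace_iff[OF S] by blast
qed

lemma intertwiner_vimage:
  assumes R: "representation R" and S: "representation S" and T: "intertwiner R S T"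
    and U: "invariant_subspace S U"
  shows "invariant_subspace R {x \<in> space_of R. T x \<in> U}"
  using U unfolding invariant_subspace_iff[OF R] invariant_subspace_iff[OF S]
  by (auto simp: intertwiner_zero[OF T R] intertwiner_add[OF T] intertwiner_scale[OF T]
      intertwiner_act[OF T] representation_zero[OF R] representation_add[OF R]
      representation_scale[OF R] representation_act[OF R])

lemma rep_equiv_image:
  assumes R: "representation R" and S: "representation S" and T: "intertwiner R S T"
    and inj: "inj_on T (space_of R)"
  shows "rep_equiv R (S\<lparr>space_of := T ` space_of R\<rparr>)"
  unfolding rep_equiv_iff
proof (intro conjI exI)
  show "representation (S\<lparr>space_of := T ` space_of R\<rparr>)"
    using representation_restrict[OF S] intertwiner_image[OF R S T] invariant_subspace_space[OF R] by blast
  show "intertwiner R (S\<lparr>space_of := T ` space_of R\<rparr>) T"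
    using T by (auto simp: intertwiner_def clinear_between_def)
qed (use R inj in \<open>auto simp: bij_betw_def\<close>)

lemma contained_inI:
  assumes R: "representation R" and S: "representation S" and T: "intertwiner R S T"
    and inj: "inj_on T (space_of R)"
  shows "contained_in R S"
  unfolding contained_in_def
  using rep_equiv_image[OF assms] intertwiner_image[OF R S T invariant_subspace_space[OF R]] by blast

text \<open>The intertwiner is regarded as a map into all of \<open>S\<close>, so that it can be
  composed with maps defined on \<open>S\<close>.\<close>

lemma contained_inE:
  assumes "contained_in R S"
  obtains U T where "invariant_subspace S U" "rep_equiv R (S\<lparr>space_of := U\<rparr>)" "intertwiner R S T"
    "bij_betw T (space_of R) U"
proof -
  obtain U where U: "invariant_subspace S U" "rep_equiv R (S\<lparr>space_of := U\<rparr>)"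
    using assms by (auto simp: contained_in_def)
  then obtain T where "intertwiner R (S\<lparr>space_of := U\<rparr>) T" "bij_betw T (space_of R) U"
    by (auto simp: rep_equiv_iff)
  moreover from this U(1) have "intertwiner R S T"
    by (auto simp: intertwiner_def clinear_between_def invariant_subspace_def)
  ultimately show thesis using that U by blast
qed

lemma intertwiner_inj_onI:
  assumes "representation R" "intertwiner R S T" "\<And>x. x \<in> space_of R \<Longrightarrow> T x = 0 \<Longrightarrow> x = 0"
  shows "inj_on T (space_of R)"
proof (rule inj_onI)
  fix x y assume "x \<in> space_of R" "y \<in> space_of R" "T x = T y"
  then have "x - y = 0"
    using assms(3)[of "x - y"] intertwiner_diff[OF assms(2,1)] representation_diff[OF assms(1)] by simp
  then show "x = y" by simp
qed

text \<open>The half of Schur's lemma about kernels: the kernel is the preimage of the invariant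
  subspace \<open>{0}\<close>, hence zero or everything.\<close>

lemma irreducible_intertwiner:
  assumes R: "irreducible_rep R" and S: "representation S" and T: "intertwiner R S T"
  shows "(\<forall>x\<in>space_of R. T x = 0) \<or> inj_on T (space_of R)"
proof -
  have R': "representation R" using R by (simp add: irreducible_rep_def)
  have "invariant_subspace S {0}"
    using representation_zero[OF S] representation_scale_zero[OF S] representation_act_zero[OF S]
    by (auto simp: invariant_subspace_iff[OF S])
  then have "invariant_subspace R {x \<in> space_of R. T x \<in> {0}}"
    by (rule intertwiner_vimage[OF R' S T])
  then have "{x \<in> space_of R. T x \<in> {0}} = {0} \<or> {x \<in> space_of R. T x \<in> {0}} = space_of R"
    using R by (simp only: irreducible_rep_def)
  then show ?thesis
    using intertwiner_inj_onI[OF R' T] by blast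
qed

subsection \<open>Permutation representations on flags\<close>

lemma perm_rep_sel [simp]:
  "space_of (perm_rep J) = {f. \<forall>V. V \<notin> flags J \<longrightarrow> f V = 0}"
  "scale_of (perm_rep J) c f = (\<lambda>V. c * f V)"
  "act (perm_rep J) g f = (\<lambda>V. if V \<in> flags J then f (flag_act J V g) else 0)"
  by (simp_all add: perm_rep_def)

lemma flags_extensional: "V \<in> flags J \<Longrightarrow> V \<in> extensional J"
  by (simp add: flags_def)

lemma representation_perm_rep:
  "representation (perm_rep J :: ('a::field ^ 'n ^ 'n, (nat \<Rightarrow> ('a ^ 'n) set) \<Rightarrow> complex) crep)"
proof -
  have vs: "vector_space (scale_of (perm_rep J) :: complex \<Rightarrow> ((nat \<Rightarrow> ('a ^ 'n) set) \<Rightarrow> complex) \<Rightarrow> _)"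
    by unfold_locales (auto simp: fun_eq_iff algebra_simps)
  show ?thesis
    unfolding representation_def vector_space_subspace_iff[OF vs] clinear_between_def
    by (intro conjI ballI allI vs)
      (auto simp: fun_eq_iff flag_act_in_flags flag_act_mult flag_act_one flags_extensional)
qed

text \<open>Summation over the fibres of \<open>Fl(n)\<close> over \<open>Fl_j(n)\<close>. Being an
  intertwiner, it turns the vanishing of panel sums into a representation-theoretic
  condition.\<close>

definition push_flags ::
  "nat \<Rightarrow> ((nat \<Rightarrow> ('a::field ^ 'n) set) \<Rightarrow> complex) \<Rightarrow> (nat \<Rightarrow> ('a ^ 'n) set) \<Rightarrow> complex" where
  "push_flags j f V' = (\<Sum>V | V \<in> complete_flags \<and> restrict V ({0..CARD('n)} - {j}) = V'. f V)"

lemma push_flags_restrict: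
  fixes V :: "nat \<Rightarrow> ('a::field ^ 'n) set"
  assumes "V \<in> complete_flags"
  shows "push_flags j f (restrict V ({0..CARD('n)} - {j})) = (\<Sum>V'\<in>panel j V. f V')"
proof -
  have "restrict V' ({0..CARD('n)} - {j}) = restrict V ({0..CARD('n)} - {j}) \<longleftrightarrow>
      (\<forall>i. i \<noteq> j \<longrightarrow> V' i = V i)" if "V' \<in> complete_flags" for V'
    using complete_flags_ext[OF that] complete_flags_ext[OF assms]
    unfolding fun_eq_iff restrict_def extensional_def by (metis (mono_tags, lifting) DiffI Diff_iff mem_Collect_eq singletonI singletonD)
  then show ?thesis
    unfolding push_flags_def panel_def by (intro sum.cong) auto
qed

lemma restrict_flag_act:
  "restrict (flag_act J V g) J' = flag_act J' (restrict V J') g" if "J' \<subseteq> J"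
  using that by (auto simp: flag_act_def fun_eq_iff)

lemma flag_act_inverse:
  fixes V :: "nat \<Rightarrow> ('a::field ^ 'n) set"
  assumes "V \<in> flags J" "g \<in> GL"
  shows "flag_act J (flag_act J V g) (matrix_inv g) = V" "flag_act J (flag_act J V (matrix_inv g)) g = V"
  using assms
  by (simp_all add: flag_act_mult GL_right_inverse GL_left_inverse flag_act_one flags_def)

lemma intertwiner_push_flags:
  "intertwiner (perm_rep {0..CARD('n)}) (perm_rep ({0..CARD('n)} - {j}))
    (push_flags j :: ((nat \<Rightarrow> ('a::field ^ 'n) set) \<Rightarrow> complex) \<Rightarrow> _)"
proof -
  let ?J = "{0..CARD('n)}" and ?J' = "{0..CARD('n)} - {j}"
  let ?p = "push_flags j :: ((nat \<Rightarrow> ('a ^ 'n) set) \<Rightarrow> complex) \<Rightarrow> _"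
  have zero: "?p f V' = 0" if "V' \<notin> flags ?J'" for f V'
  proof -
    have "{V. V \<in> complete_flags \<and> restrict V ?J' = V'} = {}"
      using that complete_flags_restrict by blast
    then show ?thesis unfolding push_flags_def by (simp only: sum.empty)
  qed
  have act: "?p (act (perm_rep ?J) g f) = act (perm_rep ?J') g (?p f)" if g: "g \<in> GL" for g f
  proof
    fix V' :: "nat \<Rightarrow> ('a ^ 'n) set"
    show "?p (act (perm_rep ?J) g f) V' = act (perm_rep ?J') g (?p f) V'"
    proof (cases "V' \<in> flags ?J'")
      case True
      have "?p (act (perm_rep ?J) g f) V' =
          (\<Sum>V | V \<in> complete_flags \<and> restrict V ?J' = V'. f (flag_act ?J V g))"
        unfolding push_flags_def by (intro sum.cong) (auto simp: complete_flags_def)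
      also have "\<dots> = (\<Sum>V | V \<in> complete_flags \<and> restrict V ?J' = flag_act ?J' V' g. f V)"
      proof (rule sum.reindex_bij_witness[where i = "\<lambda>V. flag_act ?J V (matrix_inv g)" and j = "\<lambda>V. flag_act ?J V g"])
        fix V assume "V \<in> {V. V \<in> complete_flags \<and> restrict V ?J' = V'}"
        then show "flag_act ?J (flag_act ?J V g) (matrix_inv g) = V"
          "flag_act ?J V g \<in> {V. V \<in> complete_flags \<and> restrict V ?J' = flag_act ?J' V' g}"
          using g by (auto simp: complete_flags_def flag_act_inverse flag_act_in_flags restrict_flag_act)
      next
        fix V assume "V \<in> {V. V \<in> complete_flags \<and> restrict V ?J' = flag_act ?J' V' g}"
        then show "flag_act ?J (flag_act ?J V (matrix_inv g)) g = V"
          "flag_act ?J V (matrix_inv g) \<in> {V. V \<in> complete_flags \<and> restrict V ?J' = V'}"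
          using g True GL_inverse[OF g]
          by (auto simp: complete_flags_def flag_act_inverse flag_act_in_flags restrict_flag_act)
      qed simp
      finally show ?thesis using True by (simp add: push_flags_def)
    qed (simp add: zero)
  qed
  show ?thesis
    unfolding intertwiner_def clinear_between_def
  proof (intro conjI ballI allI act)
    fix x y :: "(nat \<Rightarrow> ('a ^ 'n) set) \<Rightarrow> complex" and c
    show "?p (x + y) = ?p x + ?p y" by (simp add: push_flags_def fun_eq_iff sum.distrib)
    show "?p (scale_of (perm_rep ?J) c x) = scale_of (perm_rep ?J') c (?p x)"
      by (simp add: push_flags_def fun_eq_iff sum_distrib_left)
  qed (simp add: zero)
qed

text \<open>Cut off outside the complete flags because \<open>perm_rep\<close> encodes functions on
  flags by extension by zero.\<close>

definition kernel_section ::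
  "(nat \<Rightarrow> ('a::{field,finite} ^ 'n) set) \<Rightarrow> (nat \<Rightarrow> ('a ^ 'n) set) \<Rightarrow> complex" where
  "kernel_section W V = (if V \<in> complete_flags then flag_kernel V W else 0)"

lemma sum_apply: "(\<Sum>a\<in>A. F a) x = (\<Sum>a\<in>A. F a x)"
  for F :: "'b \<Rightarrow> 'c \<Rightarrow> 'd::comm_monoid_add"
  by (induction A rule: infinite_finite_induct) auto

lemma kernel_section_mem:
  fixes U :: "((nat \<Rightarrow> ('a::{field,finite} ^ 'n) set) \<Rightarrow> complex) set"
  assumes U: "invariant_subspace (perm_rep {0..CARD('n)}) U"
    and harm: "\<And>f. f \<in> U \<Longrightarrow> panel_harmonic f" and "U \<noteq> {0}" and V: "V \<in> complete_flags"
  shows "kernel_section V \<in> U"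
proof -
  let ?J = "{0..CARD('n)}"
  let ?P = "perm_rep ?J :: ('a ^ 'n ^ 'n, (nat \<Rightarrow> ('a ^ 'n) set) \<Rightarrow> complex) crep"
  have U': "U \<subseteq> space_of ?P" "0 \<in> U" "\<And>f c. f \<in> U \<Longrightarrow> (\<lambda>V. c * f V) \<in> U"
    "\<And>g f. g \<in> GL \<Longrightarrow> f \<in> U \<Longrightarrow> act ?P g f \<in> U"
    using U by (auto simp: invariant_subspace_iff[OF representation_perm_rep] simp del: perm_rep_sel(3))
  have mem: "kernel_section W \<in> U" if f: "f \<in> U" and W: "W \<in> complete_flags" and "f W \<noteq> 0" for f W
  proof -
    define Stab where "Stab = {g \<in> GL. flag_act ?J W g = W}"
    define y where "y = (\<Sum>g\<in>Stab. act ?P g f)"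
    have yU: "y \<in> U"
      unfolding y_def
      by (rule invariant_subspace_sum[OF representation_perm_rep U]) (simp add: U' f Stab_def del: perm_rep_sel)
    have y: "y V = (\<Sum>g\<in>Stab. f (flag_act ?J V g))" if "V \<in> complete_flags" for V
      using that by (simp add: y_def sum_apply complete_flags_def)
    have "mat 1 \<in> Stab"
      using GL_one W by (auto simp: Stab_def complete_flags_def flags_def flag_act_one)
    then have "card Stab \<noteq> 0" by auto
    \<comment> \<open>No cancellation can occur at \<open>W\<close>: the stabilizer fixes
      \<open>W\<close>, so every summand equals \<open>f W\<close>.\<close>
    moreover have "y W = of_nat (card Stab) * f W"
      by (simp add: y[OF W] Stab_def)
    ultimately have yW: "y W \<noteq> 0" using \<open>f W \<noteq> 0\<close> by simp
    have "y V = y W * flag_kernel V W" if "V \<in> complete_flags" for V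
    proof (rule panel_harmonic_stabilizer_invariant[OF harm[OF yU] W that])
      fix h :: "'a ^ 'n ^ 'n" and V :: "nat \<Rightarrow> ('a ^ 'n) set"
      assume h: "h \<in> GL" "flag_act ?J W h = W" and V: "V \<in> complete_flags"
      have hW: "flag_act ?J W (matrix_inv h) = W"
        using flag_act_inverse(1)[of W ?J h] W h by (simp add: complete_flags_def)
      have "flag_act ?J V h \<in> complete_flags"
        using V h by (simp add: complete_flags_def flag_act_in_flags)
      then have "y (flag_act ?J V h) = (\<Sum>g\<in>Stab. f (flag_act ?J V (h ** g)))"
        by (simp add: y flag_act_mult)
      also have "\<dots> = (\<Sum>g\<in>Stab. f (flag_act ?J V g))"
      proof (rule sum.reindex_bij_witness[where i = "\<lambda>g. matrix_inv h ** g" and j = "\<lambda>g. h ** g"])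
        fix g assume "g \<in> Stab"
        then show "h ** g \<in> Stab" "matrix_inv h ** g \<in> Stab"
          using h hW GL_inverse[OF h(1)] by (auto simp: Stab_def GL_mult simp flip: flag_act_mult)
      qed (simp_all add: matrix_mul_assoc GL_left_inverse GL_right_inverse h)
      finally show "y (flag_act ?J V h) = y V" by (simp add: y[OF V])
    qed
    moreover have "y V = 0" if "V \<notin> complete_flags" for V
      using yU U'(1) that by (auto simp: complete_flags_def)
    ultimately have "kernel_section W = (\<lambda>V. inverse (y W) * y V)"
      using yW by (auto simp: kernel_section_def fun_eq_iff)
    then show ?thesis using U'(3)[OF yU] by simp
  qed
  obtain f where f: "f \<in> U" "f \<noteq> 0" using \<open>U \<noteq> {0}\<close> U'(2) by blast
  then obtain W where W: "f W \<noteq> 0" by (auto simp: fun_eq_iff)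
  then have "W \<in> complete_flags" using f U'(1) by (auto simp: complete_flags_def)
  with mem f W have "kernel_section W \<in> U" by blast
  \<comment> \<open>One section yields all others: the kernel is nowhere zero, so
    \<open>kernel_section W\<close> is itself a function in \<open>U\<close> that does not vanish at
    \<open>V\<close>, and \<open>mem\<close> applies to it.\<close>
  moreover have "kernel_section W V \<noteq> 0"
    using V by (simp add: kernel_section_def flag_kernel_nonzero)
  ultimately show ?thesis using mem V by blast
qed

subsection \<open>The space of the kernel\<close>

locale flag_kernel_space =
  fixes H :: "('a::{field,finite} ^ 'n ^ 'n, 'h::ab_group_add) crep"
    and ip :: "'h \<Rightarrow> 'h \<Rightarrow> complex"
    and \<phi> :: "(nat \<Rightarrow> ('a ^ 'n) set) \<Rightarrow> 'h"
  assumes kernel_rep: "kernel_rep flag_kernel H ip \<phi>"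
begin

abbreviation P :: "('a ^ 'n ^ 'n, (nat \<Rightarrow> ('a ^ 'n) set) \<Rightarrow> complex) crep" where
  "P \<equiv> perm_rep {0..CARD('n)}"

lemma rep: "representation H"
  using kernel_rep by (simp add: kernel_rep_def)

lemma
  shows ip_add: "x \<in> space_of H \<Longrightarrow> y \<in> space_of H \<Longrightarrow> z \<in> space_of H \<Longrightarrow> ip (x + y) z = ip x z + ip y z"
    and ip_scale: "x \<in> space_of H \<Longrightarrow> y \<in> space_of H \<Longrightarrow> ip (scale_of H c x) y = c * ip x y"
    and ip_commute: "x \<in> space_of H \<Longrightarrow> y \<in> space_of H \<Longrightarrow> ip y x = cnj (ip x y)"
    and ip_pos: "x \<in> space_of H \<Longrightarrow> x \<noteq> 0 \<Longrightarrow> Re (ip x x) > 0"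
    and ip_phi: "V \<in> complete_flags \<Longrightarrow> W \<in> complete_flags \<Longrightarrow> ip (\<phi> V) (\<phi> W) = flag_kernel V W"
    and ip_act: "g \<in> GL \<Longrightarrow> x \<in> space_of H \<Longrightarrow> y \<in> space_of H \<Longrightarrow> ip (act H g x) (act H g y) = ip x y"
    and act_phi: "g \<in> GL \<Longrightarrow> V \<in> complete_flags \<Longrightarrow>
      act H g (\<phi> V) = \<phi> (flag_act {0..CARD('n)} V (matrix_inv g))"
proof -
  note K = kernel_rep[unfolded kernel_rep_def complex_inner_product_def]
  have "\<forall>x\<in>space_of H. \<forall>y\<in>space_of H. \<forall>z\<in>space_of H. ip (x + y) z = ip x z + ip y z"
    using K by (elim conjE)
  then show "x \<in> space_of H \<Longrightarrow> y \<in> space_of H \<Longrightarrow> z \<in> space_of H \<Longrightarrow> ip (x + y) z = ip x z + ip y z"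
    by blast
  have "\<forall>c. \<forall>x\<in>space_of H. \<forall>y\<in>space_of H. ip (scale_of H c x) y = c * ip x y"
    using K by (elim conjE)
  then show "x \<in> space_of H \<Longrightarrow> y \<in> space_of H \<Longrightarrow> ip (scale_of H c x) y = c * ip x y"
    by blast
  have "\<forall>x\<in>space_of H. \<forall>y\<in>space_of H. ip y x = cnj (ip x y)"
    using K by (elim conjE)
  then show "x \<in> space_of H \<Longrightarrow> y \<in> space_of H \<Longrightarrow> ip y x = cnj (ip x y)"
    by blast
  have "\<forall>x\<in>space_of H. x \<noteq> 0 \<longrightarrow> Re (ip x x) > 0"
    using K by (elim conjE)
  then show "x \<in> space_of H \<Longrightarrow> x \<noteq> 0 \<Longrightarrow> Re (ip x x) > 0"
    by blast
  have "\<forall>V\<in>complete_flags. \<forall>W\<in>complete_flags. ip (\<phi> V) (\<phi> W) = flag_kernel V W"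
    using K by (elim conjE)
  then show "V \<in> complete_flags \<Longrightarrow> W \<in> complete_flags \<Longrightarrow> ip (\<phi> V) (\<phi> W) = flag_kernel V W"
    by blast
  have "\<forall>g\<in>GL. \<forall>x\<in>space_of H. \<forall>y\<in>space_of H. ip (act H g x) (act H g y) = ip x y"
    using K by (elim conjE)
  then show "g \<in> GL \<Longrightarrow> x \<in> space_of H \<Longrightarrow> y \<in> space_of H \<Longrightarrow> ip (act H g x) (act H g y) = ip x y"
    by blast
  have "\<forall>g\<in>GL. \<forall>V\<in>complete_flags. act H g (\<phi> V) = \<phi> (flag_act {0..CARD('n)} V (matrix_inv g))"
    using K by (elim conjE)
  then show "g \<in> GL \<Longrightarrow> V \<in> complete_flags \<Longrightarrow>
      act H g (\<phi> V) = \<phi> (flag_act {0..CARD('n)} V (matrix_inv g))"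
    by blast
qed

lemma phi_space: "V \<in> complete_flags \<Longrightarrow> \<phi> V \<in> space_of H"
proof -
  have space: "space_of H = module.span (scale_of H) (\<phi> ` complete_flags)"
    using kernel_rep by (simp add: kernel_rep_def)
  interpret vector_space "scale_of H" by (rule representation_vector_space[OF rep])
  assume "V \<in> complete_flags"
  then show ?thesis unfolding space by (intro span_base) auto
qed

lemma space_subset:
  assumes "0 \<in> U" "\<And>x y. x \<in> U \<Longrightarrow> y \<in> U \<Longrightarrow> x + y \<in> U" "\<And>c x. x \<in> U \<Longrightarrow> scale_of H c x \<in> U"
    and "\<And>V. V \<in> complete_flags \<Longrightarrow> \<phi> V \<in> U"
  shows "space_of H \<subseteq> U"
proof -
  have space: "space_of H = module.span (scale_of H) (\<phi> ` complete_flags)"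
    using kernel_rep by (simp add: kernel_rep_def)
  interpret vector_space "scale_of H" by (rule representation_vector_space[OF rep])
  show ?thesis
    unfolding space using assms by (intro span_minimal) (auto simp: subspace_def)
qed

lemma invariant_subspace_eq_space:
  assumes "invariant_subspace H U" "\<And>V. V \<in> complete_flags \<Longrightarrow> \<phi> V \<in> U"
  shows "U = space_of H"
  using assms space_subset[of U] unfolding invariant_subspace_iff[OF rep] by auto

section \<open>Orthogonality and panel relations in \<open>H\<close>\<close>

lemma ip_add_right:
  "x \<in> space_of H \<Longrightarrow> y \<in> space_of H \<Longrightarrow> z \<in> space_of H \<Longrightarrow> ip x (y + z) = ip x y + ip x z"
  by (simp add: ip_commute[of "y + z" x] ip_commute[of y x] ip_commute[of z x] ip_add representation_add[OF rep])

lemma ip_scale_right: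
  "x \<in> space_of H \<Longrightarrow> y \<in> space_of H \<Longrightarrow> ip x (scale_of H c y) = cnj c * ip x y"
  by (simp add: ip_commute[of "scale_of H c y" x] ip_commute[of y x] ip_scale representation_scale[OF rep])

lemma ip_zero:
  assumes "x \<in> space_of H"
  shows "ip 0 x = 0" "ip x 0 = 0"
  using ip_add[of 0 0 x] ip_add_right[of x 0 0] assms representation_zero[OF rep] by auto

lemma ip_sum:
  assumes "\<And>a. a \<in> A \<Longrightarrow> F a \<in> space_of H" "x \<in> space_of H"
  shows "(\<Sum>a\<in>A. F a) \<in> space_of H" "ip (\<Sum>a\<in>A. F a) x = (\<Sum>a\<in>A. ip (F a) x)"
    "ip x (\<Sum>a\<in>A. F a) = (\<Sum>a\<in>A. ip x (F a))"
proof -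
  have "(\<Sum>a\<in>A. F a) \<in> space_of H \<and> ip (\<Sum>a\<in>A. F a) x = (\<Sum>a\<in>A. ip (F a) x) \<and>
      ip x (\<Sum>a\<in>A. F a) = (\<Sum>a\<in>A. ip x (F a))"
    using assms
    by (induction A rule: infinite_finite_induct)
      (auto simp: ip_zero ip_add ip_add_right representation_zero[OF rep] representation_add[OF rep])
  then show "(\<Sum>a\<in>A. F a) \<in> space_of H" "ip (\<Sum>a\<in>A. F a) x = (\<Sum>a\<in>A. ip (F a) x)"
    "ip x (\<Sum>a\<in>A. F a) = (\<Sum>a\<in>A. ip x (F a))" by auto
qed

text \<open>The \<open>\<phi> V\<close> span the space, so such an \<open>x\<close> is orthogonal to
  itself, and \<open>ip\<close> is positive.\<close>

lemma orthogonal_phi_imp_zero: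
  assumes x: "x \<in> space_of H" and orth: "\<And>V. V \<in> complete_flags \<Longrightarrow> ip x (\<phi> V) = 0"
  shows "x = 0"
proof -
  have "space_of H \<subseteq> {y \<in> space_of H. ip x y = 0}"
    by (rule space_subset)
      (auto simp: x orth phi_space ip_zero ip_add_right ip_scale_right representation_zero[OF rep]
        representation_add[OF rep] representation_scale[OF rep])
  then have "ip x x = 0" using x by blast
  then show ?thesis using ip_pos[OF x] by fastforce
qed

text \<open>The Gram matrix transfers the relations of the kernel to the spanning vectors: the panel
  sum pairs to zero with every \<open>\<phi> W\<close>.\<close>

lemma phi_panel_sum:
  assumes V: "V \<in> complete_flags" and j: "j \<in> {1..CARD('n) - 1}"
  shows "(\<Sum>V'\<in>panel j V. \<phi> V') = 0"
proof (rule orthogonal_phi_imp_zero)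
  have mem: "V' \<in> complete_flags" if "V' \<in> panel j V" for V' using that by (simp add: panel_def)
  show "(\<Sum>V'\<in>panel j V. \<phi> V') \<in> space_of H"
    using ip_sum(1)[OF _ representation_zero[OF rep]] phi_space mem by blast
  fix W :: "nat \<Rightarrow> ('a ^ 'n) set" assume W: "W \<in> complete_flags"
  have "ip (\<Sum>V'\<in>panel j V. \<phi> V') (\<phi> W) = (\<Sum>V'\<in>panel j V. ip (\<phi> V') (\<phi> W))"
    using phi_space mem W by (intro ip_sum) auto
  also have "\<dots> = (\<Sum>V'\<in>panel j V. flag_kernel V' W)"
    using mem W by (intro sum.cong) (auto simp: ip_phi)
  also have "\<dots> = 0" using panel_harmonic_kernel[OF W] V j by (auto simp: panel_harmonic_def)
  finally show "ip (\<Sum>V'\<in>panel j V. \<phi> V') (\<phi> W) = 0" .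
qed

definition eval_flags :: "'h \<Rightarrow> (nat \<Rightarrow> ('a ^ 'n) set) \<Rightarrow> complex" where
  "eval_flags x V = (if V \<in> complete_flags then ip x (\<phi> V) else 0)"

lemma intertwiner_eval_flags: "intertwiner H P eval_flags"
proof -
  have "eval_flags (act H g x) = act P g (eval_flags x)" if g: "g \<in> GL" and x: "x \<in> space_of H" for g x
  proof
    fix V :: "nat \<Rightarrow> ('a ^ 'n) set"
    show "eval_flags (act H g x) V = act P g (eval_flags x) V"
    proof (cases "V \<in> complete_flags")
      case True
      have Vg: "flag_act {0..CARD('n)} V g \<in> complete_flags"
        using True g by (simp add: complete_flags_def flag_act_in_flags)
      \<comment> \<open>The inverse in the action on the spanning vectors means that
        \<open>g\<close> carries the vector of the flag \<open>V g\<close> to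
        \<open>\<phi> V\<close>; unitarity then turns evaluation at \<open>V\<close> into evaluation
        at \<open>V g\<close>, the action of \<open>perm_rep\<close>.\<close>
      have "act H g (\<phi> (flag_act {0..CARD('n)} V g)) = \<phi> V"
        using True g Vg by (simp add: act_phi flag_act_inverse complete_flags_def)
      then have "ip (act H g x) (\<phi> V) = ip x (\<phi> (flag_act {0..CARD('n)} V g))"
        using ip_act[OF g x phi_space[OF Vg]] by simp
      then show ?thesis using True Vg by (simp add: eval_flags_def complete_flags_def)
    qed (simp add: eval_flags_def complete_flags_def)
  qed
  then show ?thesis
    by (auto simp: intertwiner_def clinear_between_def eval_flags_def fun_eq_iff ip_add ip_scale phi_space
        complete_flags_def simp del: perm_rep_sel(3))
qed

lemma inj_on_eval_flags: "inj_on eval_flags (space_of H)"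
proof (rule intertwiner_inj_onI[OF rep intertwiner_eval_flags])
  fix x assume "x \<in> space_of H" "eval_flags x = 0"
  then show "x = 0"
    by (intro orthogonal_phi_imp_zero) (auto simp: eval_flags_def fun_eq_iff split: if_splits)
qed

lemma eval_flags_phi: "W \<in> complete_flags \<Longrightarrow> eval_flags (\<phi> W) = kernel_section W"
  by (auto simp: eval_flags_def kernel_section_def fun_eq_iff ip_phi flag_kernel_commute)

lemma panel_harmonic_eval_flags:
  assumes "x \<in> space_of H"
  shows "panel_harmonic (eval_flags x)"
  unfolding panel_harmonic_def
proof (intro ballI)
  fix j and V :: "nat \<Rightarrow> ('a ^ 'n) set"
  assume j: "j \<in> {1..CARD('n) - 1}" and V: "V \<in> complete_flags"
  have mem: "V' \<in> complete_flags" if "V' \<in> panel j V" for V' using that by (simp add: panel_def)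
  have "(\<Sum>V'\<in>panel j V. eval_flags x V') = (\<Sum>V'\<in>panel j V. ip x (\<phi> V'))"
    using mem by (intro sum.cong) (auto simp: eval_flags_def)
  also have "\<dots> = ip x (\<Sum>V'\<in>panel j V. \<phi> V')"
    using mem assms phi_space by (intro ip_sum(3)[symmetric]) auto
  also have "\<dots> = 0" using phi_panel_sum[OF V j] ip_zero assms by simp
  finally show "(\<Sum>V'\<in>panel j V. eval_flags x V') = 0" .
qed

lemma phi_nonzero: "V \<in> complete_flags \<Longrightarrow> \<phi> V \<noteq> 0"
  using ip_phi[of V V] ip_zero(1)[OF phi_space, of V] flag_kernel_self[of V] by auto

text \<open>A nonzero invariant subspace has a nonzero image under \<open>eval_flags\<close>,
  consisting of harmonic functions. The image contains all kernel functions, so by injectivity the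
  subspace contains the \<open>\<phi> V\<close>, which span.\<close>

lemma irreducible: "irreducible_rep H"
  unfolding irreducible_rep_def
proof (intro conjI allI impI)
  show "space_of H \<noteq> {0}"
    using phi_space phi_nonzero complete_flags_nonempty by blast
  fix U assume U: "invariant_subspace H U"
  have sub: "U \<subseteq> space_of H" and zero: "0 \<in> U" using U by (auto simp: invariant_subspace_iff[OF rep])
  show "U = {0} \<or> U = space_of H"
  proof (cases "U = {0}")
    case False
    have "eval_flags ` U \<noteq> {0}"
    proof
      assume "eval_flags ` U = {0}"
      then have "eval_flags x = eval_flags 0" if "x \<in> U" for x
        using that zero by (metis image_eqI singletonD)
      then have "x = 0" if "x \<in> U" for x
        using inj_on_eval_flags sub zero that by (meson inj_onD subsetD)
      then show False using False zero by blast
    qed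
    then have *: "kernel_section V \<in> eval_flags ` U" if "V \<in> complete_flags" for V
      using that sub panel_harmonic_eval_flags
        intertwiner_image[OF rep representation_perm_rep intertwiner_eval_flags U]
      by (intro kernel_section_mem) auto
    have "\<phi> V \<in> U" if V: "V \<in> complete_flags" for V
    proof -
      obtain x where "x \<in> U" "eval_flags x = eval_flags (\<phi> V)"
        using *[OF V] eval_flags_phi[OF V] by auto
      then show ?thesis using inj_on_eval_flags sub phi_space[OF V] by (metis inj_onD subsetD)
    qed
    then show ?thesis using invariant_subspace_eq_space[OF U] by blast
  qed simp
qed (rule rep)

text \<open>A copy of \<open>H\<close> in the functions on \<open>Fl\<^sub>j\<close> gives a kernel \<open>F V W\<close> which is constant on
  \<open>j\<close>-panels in \<open>V\<close>; being panel harmonic and stabilizer invariant in \<open>W\<close>, it is \<open>c V\<close> times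
  the reproducing kernel. As the latter has modulus less than 1 off the diagonal, \<open>c\<close> vanishes.\<close>

lemma not_contained:
  assumes j: "j \<in> {1..CARD('n) - 1}"
  shows "\<not> contained_in H
    (perm_rep ({0..CARD('n)} - {j}) :: ('a ^ 'n ^ 'n, (nat \<Rightarrow> ('a ^ 'n) set) \<Rightarrow> complex) crep)"
proof
  let ?J = "{0..CARD('n)}" and ?J' = "{0..CARD('n)} - {j}"
  assume "contained_in H (perm_rep ?J' :: ('a ^ 'n ^ 'n, (nat \<Rightarrow> ('a ^ 'n) set) \<Rightarrow> complex) crep)"
  then obtain U and T :: "'h \<Rightarrow> (nat \<Rightarrow> ('a ^ 'n) set) \<Rightarrow> complex"
    where T: "intertwiner H (perm_rep ?J') T" "bij_betw T (space_of H) U"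
    by (elim contained_inE) blast
  obtain i where i: "j = Suc i" "Suc i < CARD('n)" using j by (cases j) auto
  define F where "F V W = T (\<phi> W) (restrict V ?J')" for V W
  define c where "c V = F V V" for V
  have F: "F V W = c V * flag_kernel W V" if V: "V \<in> complete_flags" and W: "W \<in> complete_flags" for V W
    unfolding c_def
  proof (rule panel_harmonic_stabilizer_invariant[OF _ V W])
    show "panel_harmonic (F V)"
      unfolding panel_harmonic_def
    proof (intro ballI)
      fix k and W :: "nat \<Rightarrow> ('a ^ 'n) set"
      assume k: "k \<in> {1..CARD('n) - 1}" and W: "W \<in> complete_flags"
      have "(\<Sum>W'\<in>panel k W. T (\<phi> W')) = T (\<Sum>W'\<in>panel k W. \<phi> W')"
        by (intro intertwiner_sum(2)[OF T(1) rep, symmetric] phi_space) (simp add: panel_def)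
      also have "\<dots> = 0"
        using phi_panel_sum[OF W k] intertwiner_zero[OF T(1) rep] by simp
      finally have "(\<Sum>W'\<in>panel k W. T (\<phi> W')) (restrict V ?J') = 0" by simp
      then show "(\<Sum>W'\<in>panel k W. F V W') = 0"
        by (simp add: F_def sum_apply)
    qed
    fix g :: "'a ^ 'n ^ 'n" and W :: "nat \<Rightarrow> ('a ^ 'n) set"
    assume g: "g \<in> GL" "flag_act ?J V g = V" and W: "W \<in> complete_flags"
    have Vg: "flag_act ?J V (matrix_inv g) = V"
      using flag_act_inverse(1)[of V ?J g] V g by (simp add: complete_flags_def)
    have "\<phi> (flag_act ?J W g) = act H (matrix_inv g) (\<phi> W)"
      using act_phi[OF GL_inverse[OF g(1)] W] GL_inverse_inverse[OF g(1)] by simp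
    then have "T (\<phi> (flag_act ?J W g)) = act (perm_rep ?J') (matrix_inv g) (T (\<phi> W))"
      using intertwiner_act[OF T(1) GL_inverse[OF g(1)] phi_space[OF W]] by simp
    moreover have "flag_act ?J' (restrict V ?J') (matrix_inv g) = restrict V ?J'"
      using restrict_flag_act[of ?J' ?J V "matrix_inv g"] Vg by auto
    ultimately show "F V (flag_act ?J W g) = F V W"
      using complete_flags_restrict[OF V, of j] by (simp add: F_def)
  qed
  have c0: "c V = 0" if V: "V \<in> complete_flags" for V
  proof -
    obtain W where W: "W \<in> panel (Suc i) V" "W \<noteq> V" using panel_nontrivial[OF V i(2)] by blast
    then have WX: "W \<in> complete_flags" by (simp add: panel_def)
    \<comment> \<open>Both flags have the same restriction, so \<open>F\<close> has the same value
      with \<open>V\<close> or \<open>W\<close> as first argument. This gives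
      \<open>c V = c V * flag_kernel W V ^ 2\<close>, with a factor of modulus below 1.\<close>
    have "restrict W ?J' = restrict V ?J'" using W i by (auto simp: panel_def fun_eq_iff)
    then have "F V W = c W" "F W V = c V" by (simp_all add: F_def c_def)
    then have cc: "c W = c V * flag_kernel W V" "c V = c W * flag_kernel W V"
      using F[OF V WX] F[OF WX V] flag_kernel_commute[of V W] by simp_all
    have less: "norm (flag_kernel W V) < 1" using norm_flag_kernel_less[OF WX V W(2)] .
    then have sq: "norm (flag_kernel W V) * norm (flag_kernel W V) < 1"
      by (metis mult_strict_mono mult_1 norm_ge_zero zero_less_one)
    have "norm (c V) = norm (c V) * (norm (flag_kernel W V) * norm (flag_kernel W V))"
      using cc by (metis mult.assoc norm_mult)
    then show "c V = 0" using sq by auto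
  qed
  obtain W :: "nat \<Rightarrow> ('a ^ 'n) set" where W: "W \<in> complete_flags"
    using complete_flags_nonempty by blast
  \<comment> \<open>Every incomplete flag is a restriction, so the vanishing of all
    \<open>c V\<close> makes \<open>T\<close> kill the nonzero vector \<open>\<phi> W\<close>,
    against injectivity.\<close>
  have "T (\<phi> W) V' = 0" for V'
  proof (cases "V' \<in> flags ?J'")
    case True
    then obtain V where "V \<in> complete_flags" "restrict V ?J' = V'"
      using flags_restrict_surj i by metis
    then show ?thesis using F[of V W] c0[of V] W by (simp add: F_def)
  next
    case False
    then show ?thesis using intertwiner_mem[OF T(1) phi_space[OF W]] by simp
  qed
  then have "T (\<phi> W) = T 0" using intertwiner_zero[OF T(1) rep] by auto
  then have "\<phi> W = 0"
    by (rule inj_onD[OF bij_betw_imp_inj_on[OF T(2)] _ phi_space[OF W] representation_zero[OF rep]])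
  then show False using phi_nonzero W by blast
qed

lemma steinberg: "steinberg H"
  unfolding steinberg_def
  using irreducible not_contained
    contained_inI[OF rep representation_perm_rep intertwiner_eval_flags inj_on_eval_flags] by blast

text \<open>A copy of \<open>S\<close> inside the functions on \<open>Fl(n)\<close> turns out to
  equal the image of \<open>H\<close> as a subspace, not merely up to isomorphism.\<close>

lemma steinberg_equiv:
  fixes S :: "('a ^ 'n ^ 'n, 'v::ab_group_add) crep"
  assumes S: "steinberg S"
  shows "rep_equiv H S"
proof -
  have irr: "irreducible_rep S" and cont: "contained_in S P"
    and ncont: "\<And>j. j \<in> {1..CARD('n) - 1} \<Longrightarrow> \<not> contained_in S
      (perm_rep ({0..CARD('n)} - {j}) :: ('a ^ 'n ^ 'n, (nat \<Rightarrow> ('a ^ 'n) set) \<Rightarrow> complex) crep)"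
    using S unfolding steinberg_def by blast+
  have Srep: "representation S" using irr by (simp add: irreducible_rep_def)
  obtain U T where U: "invariant_subspace P U" "rep_equiv S (P\<lparr>space_of := U\<rparr>)" "intertwiner S P T"
    "bij_betw T (space_of S) U"
    using cont by (elim contained_inE)
  have TU: "U = T ` space_of S" and injT: "inj_on T (space_of S)" using U(4) by (auto simp: bij_betw_def)
  have harm: "panel_harmonic f" if "f \<in> U" for f
    unfolding panel_harmonic_def
  proof (intro ballI)
    fix j and V :: "nat \<Rightarrow> ('a ^ 'n) set"
    assume j: "j \<in> {1..CARD('n) - 1}" and V: "V \<in> complete_flags"
    have int: "intertwiner S (perm_rep ({0..CARD('n)} - {j})) (push_flags j \<circ> T)"
      by (rule intertwiner_comp[OF U(3) intertwiner_push_flags])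
    \<comment> \<open>An injective summation map would embed \<open>S\<close> in the functions on
      \<open>Fl_j(n)\<close>. By Schur's lemma it is then zero on \<open>U\<close>, which is the
      vanishing of the panel sums.\<close>
    have "\<not> inj_on (push_flags j \<circ> T) (space_of S)"
      using contained_inI[OF Srep representation_perm_rep int] ncont[OF j] by blast
    then have "\<forall>x\<in>space_of S. (push_flags j \<circ> T) x = 0"
      using irreducible_intertwiner[OF irr representation_perm_rep int] by blast
    then have "push_flags j f = 0" using that TU by auto
    then show "(\<Sum>V'\<in>panel j V. f V') = 0"
      using push_flags_restrict[OF V, of j f] by simp
  qed
  have "U \<noteq> {0}"
  proof
    assume "U = {0}"
    then have "T x = T 0" if "x \<in> space_of S" for x
      using that TU representation_zero[OF Srep] by (metis imageI singletonD)
    then have "space_of S = {0}"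
      using injT representation_zero[OF Srep] by (auto dest: inj_onD)
    then show False using irr by (simp add: irreducible_rep_def)
  qed
  then have ker: "kernel_section V \<in> U" if "V \<in> complete_flags" for V
    using kernel_section_mem[OF U(1) harm _ that] by blast
  define M where "M = eval_flags ` space_of H"
  have M: "invariant_subspace P M"
    unfolding M_def
    using intertwiner_image[OF rep representation_perm_rep intertwiner_eval_flags invariant_subspace_space[OF rep]] .
  have "{x \<in> space_of H. eval_flags x \<in> U} = space_of H"
    by (rule invariant_subspace_eq_space)
      (use intertwiner_vimage[OF rep representation_perm_rep intertwiner_eval_flags U(1)] ker
        in \<open>auto simp: phi_space eval_flags_phi\<close>)
  then have MU: "M \<subseteq> U" unfolding M_def by blast
  \<comment> \<open>Irreducibility is given for \<open>S\<close>, so \<open>M\<close> is pulled back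
    along \<open>T\<close>. The pullback cannot be \<open>{0}\<close>, because \<open>M\<close>
    contains the nonzero image of \<open>\<phi> V\<close>.\<close>
  have "invariant_subspace S {x \<in> space_of S. T x \<in> M}"
    by (rule intertwiner_vimage[OF Srep representation_perm_rep U(3) M])
  then consider "{x \<in> space_of S. T x \<in> M} = {0}" | "{x \<in> space_of S. T x \<in> M} = space_of S"
    using irr unfolding irreducible_rep_def by blast
  then have "M = U"
  proof cases
    case 1
    obtain V :: "nat \<Rightarrow> ('a ^ 'n) set" where V: "V \<in> complete_flags"
      using complete_flags_nonempty by blast
    then have "eval_flags (\<phi> V) \<in> M" unfolding M_def using phi_space by blast
    then obtain x where "x \<in> space_of S" "T x = eval_flags (\<phi> V)" "T x \<in> M" using MU TU by auto
    moreover from this have "x = 0" using 1 by blast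
    ultimately have "eval_flags (\<phi> V) = eval_flags 0"
      using intertwiner_zero[OF U(3) Srep] intertwiner_zero[OF intertwiner_eval_flags rep] by metis
    then have "\<phi> V = 0"
      by (rule inj_onD[OF inj_on_eval_flags _ phi_space[OF V] representation_zero[OF rep]])
    then show ?thesis using phi_nonzero[OF V] by blast
  next
    case 2
    then show ?thesis using MU TU by blast
  qed
  then have "rep_equiv H (P\<lparr>space_of := U\<rparr>)"
    using rep_equiv_image[OF rep representation_perm_rep intertwiner_eval_flags inj_on_eval_flags]
    unfolding M_def by simp
  then show ?thesis using rep_equiv_trans rep_equiv_sym U(2) by blast
qed

end

theorem lemma4:
  fixes H :: "('a::{field,finite} ^ 'n ^ 'n, 'h::ab_group_add) crep"
    and ip :: "'h \<Rightarrow> 'h \<Rightarrow> complex"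
    and \<phi> :: "(nat \<Rightarrow> ('a ^ 'n) set) \<Rightarrow> 'h"
  assumes "kernel_rep flag_kernel H ip \<phi>"
  shows "steinberg H \<and>
    (\<forall>S :: ('a ^ 'n ^ 'n, 'v::ab_group_add) crep. steinberg S \<longrightarrow> rep_equiv H S)"
proof -
  interpret flag_kernel_space H ip \<phi>
    by unfold_locales (rule assms)
  show ?thesis using steinberg steinberg_equiv by blast
qed

end
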